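(* Fix $0<a<1/\pi^2$. Then $$a\int_{-\infty}^{\infty}|g'(x)|^2\,dx+\left(\frac{1}{2\pi\sqrt{a}}\log\left(\frac{1+\sqrt{a}\,\pi}{1-\sqrt{a}\,\pi}\right)\right)^{-1}\le\int_{-\infty}^{\infty}|g(x)|^2\,dx$$ for every $g\in PW^2$ with $g(0)=1$.
   Context: $PW^2$ is the Paley--Wiener space of entire functions $g:\mathbb{C}\to\mathbb{C}$ of exponential type at most $\pi$ whose restriction to $\mathbb{R}$ belongs to $L^2(\mathbb{R})$. An entire function $G$ has exponential type at most $\tau>0$ if for every $\varepsilon>0$ there is $C_\varepsilon>0$ with $|G(z)|\le C_\varepsilon e^{(\tau+\varepsilon)|z|}$ for all $z\in\mathbb{C}$. $\log$ is the natural logarithm. *)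

theory Defs
  imports "HOL-Analysis.Analysis"
begin

definition exp_type_at_most :: "real \<Rightarrow> (complex \<Rightarrow> complex) \<Rightarrow> bool" where
  "exp_type_at_most \<tau> G \<longleftrightarrow>
     (\<forall>\<epsilon>>0. \<exists>C>0. \<forall>z. cmod (G z) \<le> C * exp ((\<tau> + \<epsilon>) * cmod z))"

(* The restriction of g to the real line is continuous, hence measurable, so that
   it lies in L^2 iff its squared modulus is integrable. *)
definition PW2 :: "(complex \<Rightarrow> complex) set" where
  "PW2 = {g. g holomorphic_on UNIV \<and> exp_type_at_most pi g \<and>
             integrable lborel (\<lambda>x::real. (cmod (g (complex_of_real x)))\<^sup>2)}"

end

theory Submission
  imports Defs "HOL-Complex_Analysis.Complex_Analysis" "HOL-Probability.Sinc_Integral"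
    "HOL-Real_Asymp.Real_Asymp"
begin

text \<open>
  Consider the form \<open>B(f, h) = \<langle>f, h\<rangle> - a \<langle>f', h'\<rangle>\<close> on the Paley-Wiener space. By the Bernstein
  inequality \<open>\<parallel>h'\<parallel> \<le> \<pi> \<parallel>h\<parallel>\<close> and \<open>a < 1 / \<pi>\<^sup>2\<close> it is positive semidefinite. The function
  \<open>K(z) = 1/(2\<pi>) \<integral> e\<^bsup>izt\<^esup> / (1 - a t\<^sup>2) dt\<close> over \<open>[-\<pi>, \<pi>]\<close> satisfies \<open>K + a K'' = sinc\<close>, so that
  \<open>B(g, K) = \<langle>g, sinc\<rangle> = g(0)\<close> after an integration by parts. Expanding
  \<open>B(g - K / K(0), g - K / K(0)) \<ge> 0\<close> for \<open>g(0) = 1\<close> gives \<open>B(g, g) \<ge> 1 / K(0)\<close>, and \<open>K(0)\<close> is the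
  logarithm in the claim.

  No Fourier transform is needed. Phragmen-Lindeloef and Cauchy's estimate bound
  the norms \<open>\<parallel>g\<^bsup>(k)\<^esup>\<parallel>\<close> by \<open>k! R\<^bsup>-k\<^esup> e\<^bsup>\<pi>R\<^esup> \<parallel>g\<parallel>\<close>; these norms are log-convex in \<open>k\<close>, which improves the
  bound for \<open>k = 1\<close> to the sharp constant. The identity \<open>\<langle>g, sinc\<rangle> = g(0)\<close> comes from shifting
  contours for the kernels \<open>sin(\<sigma>x)/(\<pi>x)\<close> with \<open>\<sigma> > \<pi>\<close> and letting \<open>\<sigma>\<close> tend to \<open>\<pi>\<close>.
\<close>

subsection \<open>Integrals over the line\<close>

text \<open>Bridge between the gauge integral over intervals, where the fundamental theorem of
  calculus is applied, and the Lebesgue integral over the line, where norms and limit theorems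
  live.\<close>

lemma integral_Icc_eq_lborel:
  fixes f :: "real \<Rightarrow> 'a::euclidean_space"
  assumes "continuous_on UNIV f"
  shows "integral {a..b} f = (\<integral>x. indicator {a..b} x *\<^sub>R f x \<partial>lborel)"
    and "integrable lborel (\<lambda>x. indicator {a..b} x *\<^sub>R f x)"
proof -
  have "set_integrable lborel {a..b} f"
    by (rule borel_integrable_atLeastAtMost') (rule continuous_on_subset[OF assms], simp)
  then show "integral {a..b} f = (\<integral>x. indicator {a..b} x *\<^sub>R f x \<partial>lborel)"
    "integrable lborel (\<lambda>x. indicator {a..b} x *\<^sub>R f x)"
    using set_borel_integral_eq_integral(2)[of "{a..b}" f]
    by (auto simp: set_lebesgue_integral_def set_integrable_def)
qed

lemma integral_Icc_tendsto_lborel: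
  fixes f :: "real \<Rightarrow> 'a::euclidean_space"
  assumes "continuous_on UNIV f" "integrable lborel f"
  shows "((\<lambda>T. integral {-T..T} f) \<longlongrightarrow> (\<integral>x. f x \<partial>lborel)) at_top"
  unfolding integral_Icc_eq_lborel(1)[OF assms(1)]
proof (rule integral_dominated_convergence_at_top)
  show "f \<in> borel_measurable lborel"
    using assms(2) by auto
  show "(\<lambda>x. indicator {-t..t} x *\<^sub>R f x) \<in> borel_measurable lborel" for t :: real
    by (rule borel_measurable_integrable[OF integral_Icc_eq_lborel(2)[OF assms(1)]])
  show "integrable lborel (\<lambda>x. norm (f x))"
    using assms(2) by simp
  show "AE x in lborel. ((\<lambda>t. indicator {-t..t} x *\<^sub>R f x) \<longlongrightarrow> f x) at_top"
  proof (rule AE_I2)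
    fix x :: real
    have "\<forall>\<^sub>F t in at_top. \<bar>x\<bar> \<le> t"
      by (rule eventually_ge_at_top)
    then have "\<forall>\<^sub>F t in at_top. indicator {-t..t} x *\<^sub>R f x = f x"
      by eventually_elim (auto simp: indicator_def)
    then show "((\<lambda>t. indicator {-t..t} x *\<^sub>R f x) \<longlongrightarrow> f x) at_top"
      by (rule tendsto_eventually)
  qed
  show "\<forall>\<^sub>F i in at_top. AE x in lborel. norm (indicator {-i..i} x *\<^sub>R f x) \<le> norm (f x)"
    by (intro always_eventually allI AE_I2) (auto simp: indicator_def)
qed

lemma integral_Icc_le_lborel:
  fixes f :: "real \<Rightarrow> real"
  assumes "continuous_on UNIV f" "integrable lborel f" "\<And>x. 0 \<le> f x"
  shows "integral {a..b} f \<le> (\<integral>x. f x \<partial>lborel)"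
  unfolding integral_Icc_eq_lborel(1)[OF assms(1)]
  by (rule integral_mono[OF integral_Icc_eq_lborel(2)[OF assms(1)] assms(2)])
     (use assms(3) in \<open>auto simp: indicator_def\<close>)

text \<open>Monotone convergence along the truncations to [-n, n]. Integrability is a conclusion
  here: it is how derivatives of Paley-Wiener functions are shown to be square integrable.\<close>

lemma integrable_lborel_if_bounded_on_Icc:
  fixes f :: "real \<Rightarrow> real"
  assumes cont: "continuous_on UNIV f" and nonneg: "\<And>x. 0 \<le> f x"
    and bound: "\<And>N. 0 \<le> N \<Longrightarrow> integral {-N..N} f \<le> B"
  shows "integrable lborel f" and "(\<integral>x. f x \<partial>lborel) \<le> B"
proof -
  define F where "F n x = indicator {-real n..real n} x *\<^sub>R f x" for n x
  have F: "integrable lborel (F n)" "integral\<^sup>L lborel (F n) = integral {-real n..real n} f" for n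
    unfolding F_def using integral_Icc_eq_lborel[OF cont] by auto
  have F_mono: "F n x \<le> F m x" if "n \<le> m" for n m x
    using that nonneg by (auto simp: F_def indicator_def)
  have le: "integral\<^sup>L lborel (F n) \<le> B" for n
    using bound[of "real n"] F by simp
  have "incseq (\<lambda>n. integral\<^sup>L lborel (F n))"
    by (intro incseq_SucI integral_mono F F_mono) simp
  then obtain L where L: "(\<lambda>n. integral\<^sup>L lborel (F n)) \<longlonglongrightarrow> L"
    using incseq_convergent le by metis
  have lim: "(\<lambda>n. F n x) \<longlonglongrightarrow> f x" for x
  proof (rule tendsto_eventually)
    have "\<forall>\<^sub>F n in sequentially. nat \<lceil>\<bar>x\<bar>\<rceil> \<le> n"
      by (rule eventually_ge_at_top)
    then show "\<forall>\<^sub>F n in sequentially. F n x = f x"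
    proof eventually_elim
      case (elim n)
      then have "\<bar>x\<bar> \<le> real n" by linarith
      then have "-real n \<le> x" "x \<le> real n" by linarith+
      then show ?case by (simp add: F_def)
    qed
  qed
  note conv = integral_monotone_convergence_nonneg[OF F(1) _ _ _ L, of f]
  have "integrable lborel f \<and> integral\<^sup>L lborel f = L"
    by (intro conjI conv AE_I2 lim)
       (auto simp: mono_def F_mono F_def nonneg indicator_def
          intro!: borel_measurable_continuous_onI cont)
  moreover have "L \<le> B"
    by (rule LIMSEQ_le_const2[OF L]) (use le in auto)
  ultimately show "integrable lborel f" "(\<integral>x. f x \<partial>lborel) \<le> B"
    by auto
qed

text \<open>No decay of \<open>f\<close> is assumed. The integral of \<open>f'\<close> over [-T, T]
  is f(T) - f(-T) and converges; were the limit I nonzero, this difference would eventually exceed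
  |I|/2 in modulus, although it is an integrable function of T.\<close>

lemma lborel_integral_derivative_eq_0:
  fixes f f' :: "real \<Rightarrow> real"
  assumes deriv: "\<And>x. (f has_real_derivative f' x) (at x)"
    and cont: "continuous_on UNIV f'"
    and f: "integrable lborel f" and f': "integrable lborel f'"
  shows "(\<integral>x. f' x \<partial>lborel) = 0"
proof (rule ccontr)
  define I where "I = (\<integral>x. f' x \<partial>lborel)"
  assume "(\<integral>x. f' x \<partial>lborel) \<noteq> 0"
  then have "I \<noteq> 0" by (simp add: I_def)
  define h where "h x = f x - f (-x)" for x
  have ftc: "integral {-T..T} f' = h T" if "0 \<le> T" for T
    unfolding h_def
    by (intro integral_unique fundamental_theorem_of_calculus)
       (use that deriv in \<open>auto simp: has_real_derivative_iff_has_vector_derivative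
          intro: has_vector_derivative_at_within\<close>)
  have "((\<lambda>T. integral {-T..T} f') \<longlongrightarrow> I) at_top"
    unfolding I_def by (rule integral_Icc_tendsto_lborel[OF cont f'])
  then have "\<forall>\<^sub>F T in at_top. dist (integral {-T..T} f') I < \<bar>I\<bar> / 2"
    by (rule tendstoD) (use \<open>I \<noteq> 0\<close> in auto)
  then obtain T0 where T0: "\<And>T. T0 \<le> T \<Longrightarrow> dist (integral {-T..T} f') I < \<bar>I\<bar> / 2"
    by (auto simp: eventually_at_top_linorder)
  define T1 where "T1 = max 0 T0"
  have big: "\<bar>I\<bar> / 2 \<le> \<bar>h x\<bar>" if "T1 \<le> x" for x
    using T0[of x] ftc[of x] that unfolding T1_def dist_real_def by (simp; linarith)
  have h: "integrable lborel h"
    unfolding h_def using f lborel_integrable_real_affine[OF f, of "-1" 0] by simp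
  have "\<bar>I\<bar> / 2 * n \<le> integral\<^sup>L lborel (\<lambda>x. \<bar>h x\<bar>)" if "0 \<le> n" for n :: real
  proof -
    have "\<bar>I\<bar> / 2 * n = (\<integral>x. indicator {T1..T1+n} x *\<^sub>R (\<bar>I\<bar> / 2) \<partial>lborel)"
      using that by simp
    also have "\<dots> \<le> integral\<^sup>L lborel (\<lambda>x. \<bar>h x\<bar>)"
      proof (rule integral_mono)
        show "integrable lborel (\<lambda>x. indicator {T1..T1+n} x *\<^sub>R (\<bar>I\<bar> / 2))"
          by (rule integral_Icc_eq_lborel(2)) simp
        show "indicator {T1..T1+n} x *\<^sub>R (\<bar>I\<bar> / 2) \<le> \<bar>h x\<bar>" for x
          using big[of x] by (cases "x \<in> {T1..T1+n}") simp_all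
      qed (use h in simp)
    finally show ?thesis .
  qed
  \<comment> \<open>This length makes the lower bound exceed the integral of |h| by exactly
    1.\<close>
  from this[of "(integral\<^sup>L lborel (\<lambda>x. \<bar>h x\<bar>) + 1) / (\<bar>I\<bar> / 2)"] \<open>I \<noteq> 0\<close>
  show False
    by (simp add: divide_simps split: if_splits)
qed

section \<open>Square-integrable continuous functions on the line\<close>

text \<open>Continuity is built in, which settles measurability and integrability on compact
  intervals; it holds for every restriction of an entire function.\<close>

definition L2 :: "(real \<Rightarrow> 'a::euclidean_space) \<Rightarrow> bool" where
  "L2 f \<longleftrightarrow> continuous_on UNIV f \<and> integrable lborel (\<lambda>x. (norm (f x))\<^sup>2)"

definition L2_sqnorm :: "(real \<Rightarrow> 'a::euclidean_space) \<Rightarrow> real" where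
  "L2_sqnorm f = (\<integral>x. (norm (f x))\<^sup>2 \<partial>lborel)"

text \<open>For complex values \<open>\<bullet>\<close> is the real inner product, so this is the
  real part of the Hermitian product: a symmetric, real bilinear form.\<close>

definition L2_inner :: "(real \<Rightarrow> 'a::euclidean_space) \<Rightarrow> (real \<Rightarrow> 'a) \<Rightarrow> real" where
  "L2_inner f h = (\<integral>x. f x \<bullet> h x \<partial>lborel)"

lemma L2_I:
  assumes "continuous_on UNIV f" "integrable lborel (\<lambda>x. (norm (f x))\<^sup>2)"
  shows "L2 f"
  using assms by (simp add: L2_def)

lemma L2_continuous: "L2 f \<Longrightarrow> continuous_on A f"
  by (auto simp: L2_def intro: continuous_on_subset)

lemma L2_measurable: "L2 f \<Longrightarrow> f \<in> borel_measurable borel"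
  by (rule borel_measurable_continuous_onI) (rule L2_continuous)

lemma L2_norm2_integrable: "L2 f \<Longrightarrow> integrable lborel (\<lambda>x. (norm (f x))\<^sup>2)"
  by (simp add: L2_def)

lemma abs_inner_le_sum_squares: "\<bar>x \<bullet> y\<bar> \<le> (norm x)\<^sup>2 + (norm y)\<^sup>2"
proof -
  have "\<bar>x \<bullet> y\<bar> \<le> norm x * norm y"
    by (rule Cauchy_Schwarz_ineq2)
  also have "\<dots> \<le> (norm x)\<^sup>2 + (norm y)\<^sup>2"
    using sum_squares_bound[of "norm x" "norm y"] mult_nonneg_nonneg[of "norm x" "norm y"]
      norm_ge_zero[of x] norm_ge_zero[of y]
    by linarith
  finally show ?thesis .
qed

lemma L2_inner_integrable:
  assumes "L2 f" "L2 h"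
  shows "integrable lborel (\<lambda>x. f x \<bullet> h x)"
proof (rule Bochner_Integration.integrable_bound)
  show "integrable lborel (\<lambda>x. (norm (f x))\<^sup>2 + (norm (h x))\<^sup>2)"
    using assms by (simp add: L2_def)
  show "(\<lambda>x. f x \<bullet> h x) \<in> borel_measurable lborel"
    using assms by (intro borel_measurable_inner) (auto intro: L2_measurable)
  show "AE x in lborel. norm (f x \<bullet> h x) \<le> norm ((norm (f x))\<^sup>2 + (norm (h x))\<^sup>2)"
    by (simp add: abs_inner_le_sum_squares)
qed

lemma L2_scaleR: "L2 f \<Longrightarrow> L2 (\<lambda>x. c *\<^sub>R f x)"
  unfolding L2_def norm_scaleR power_mult_distrib
  by (intro conjI integrable_mult_right continuous_on_scaleR continuous_on_const) auto

lemma L2_add: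
  assumes "L2 f" "L2 h"
  shows "L2 (\<lambda>x. f x + h x)"
proof (rule L2_I)
  have "(norm (f x + h x))\<^sup>2 = (norm (f x))\<^sup>2 + 2 * (f x \<bullet> h x) + (norm (h x))\<^sup>2" for x
    by (simp add: power2_norm_eq_inner inner_add_left inner_add_right inner_commute[of "h x" "f x"])
  then show "integrable lborel (\<lambda>x. (norm (f x + h x))\<^sup>2)"
    using assms L2_inner_integrable[OF assms] by (simp add: L2_norm2_integrable)
  show "continuous_on UNIV (\<lambda>x. f x + h x)"
    by (intro continuous_on_add L2_continuous assms)
qed

lemma L2_sqnorm_nonneg: "0 \<le> L2_sqnorm f"
  by (simp add: L2_sqnorm_def)

lemma L2_sqnorm_add_scaleR:
  assumes "L2 f" "L2 h"
  shows "L2_sqnorm (\<lambda>x. f x + c *\<^sub>R h x) = L2_sqnorm f + 2 * c * L2_inner f h + c\<^sup>2 * L2_sqnorm h"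
proof -
  have "(norm (f x + c *\<^sub>R h x))\<^sup>2 = (norm (f x))\<^sup>2 + 2 * c * (f x \<bullet> h x) + c\<^sup>2 * (norm (h x))\<^sup>2" for x
    unfolding power2_norm_eq_inner
    by (simp add: inner_add_left inner_add_right inner_commute[of "h x" "f x"] power2_eq_square algebra_simps)
  then show ?thesis
    using L2_inner_integrable[OF assms] assms[THEN L2_norm2_integrable]
    by (simp add: L2_sqnorm_def L2_inner_def)
qed

text \<open>The square norm of f + c h is a quadratic in c that is nowhere negative.\<close>

lemma L2_inner_Cauchy_Schwarz:
  assumes "L2 f" "L2 h"
  shows "(L2_inner f h)\<^sup>2 \<le> L2_sqnorm f * L2_sqnorm h"
proof -
  have *: "0 \<le> L2_sqnorm f + 2 * c * L2_inner f h + c\<^sup>2 * L2_sqnorm h" for c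
    using L2_sqnorm_add_scaleR[OF assms, of c] L2_sqnorm_nonneg[of "\<lambda>x. f x + c *\<^sub>R h x"] by simp
  show ?thesis
  proof (cases "L2_sqnorm h = 0")
    case True
    have "L2_inner f h = 0"
    proof (rule ccontr)
      assume "L2_inner f h \<noteq> 0"
      then show False
        \<comment> \<open>With vanishing quadratic term the expression is affine in c; this c gives
          it the value -1.\<close>
        using *[of "- (L2_sqnorm f + 1) / (2 * L2_inner f h)"] True by (simp add: field_simps)
    qed
    then show ?thesis using True by simp
  next
    case False
    then have "L2_sqnorm h > 0" using L2_sqnorm_nonneg[of h] by simp
    \<comment> \<open>This c minimizes the quadratic.\<close>
    with *[of "- L2_inner f h / L2_sqnorm h"] show ?thesis
      by (simp add: power2_eq_square field_simps)
  qed
qed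

text \<open>The pointwise product of f and h is integrable with integrable derivative, so that
  derivative has integral zero and no boundary terms appear.\<close>

lemma L2_inner_parts:
  assumes f: "\<And>x. (f has_vector_derivative f' x) (at x)"
    and h: "\<And>x. (h has_vector_derivative h' x) (at x)"
    and L2: "L2 f" "L2 f'" "L2 h" "L2 h'"
  shows "L2_inner f' h = - L2_inner f h'"
proof -
  have "(\<integral>x. f x \<bullet> h' x + f' x \<bullet> h x \<partial>lborel) = 0"
  proof (rule lborel_integral_derivative_eq_0)
    show "((\<lambda>x. f x \<bullet> h x) has_real_derivative f x \<bullet> h' x + f' x \<bullet> h x) (at x)" for x
      using f[of x] h[of x]
      unfolding has_real_derivative_iff_has_vector_derivative has_vector_derivative_def
      by (auto intro!: derivative_eq_intros simp: algebra_simps)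
    show "continuous_on UNIV (\<lambda>x. f x \<bullet> h' x + f' x \<bullet> h x)"
      using L2 by (intro continuous_intros L2_continuous)
  qed (use L2 in \<open>auto intro: L2_inner_integrable\<close>)
  then show ?thesis
    using L2_inner_integrable[OF L2(1,4)] L2_inner_integrable[OF L2(2,3)] by (simp add: L2_inner_def)
qed

text \<open>The derivative of |f|^2 is twice the integrable function
  \<open>f x \<bullet> f' x\<close>, so |f|^2 stays within a fixed distance of its value at 0. This
  supplies the bound on the real line that the growth estimates start from.\<close>

lemma L2_derivative_imp_bounded:
  assumes f: "\<And>x. (f has_vector_derivative f' x) (at x)"
    and L2: "L2 f" "L2 f'"
  obtains M where "0 \<le> M" "\<And>x. norm (f x) \<le> M"
proof -
  have abs: "integrable lborel (\<lambda>x. \<bar>f x \<bullet> f' x\<bar>)"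
    using L2_inner_integrable[OF L2] by simp
  define J where "J = (\<integral>x. \<bar>f x \<bullet> f' x\<bar> \<partial>lborel)"
  have cont: "continuous_on A (\<lambda>x. f x \<bullet> f' x)" for A
    using L2 by (intro continuous_intros L2_continuous)
  have J: "\<bar>integral {a..b} (\<lambda>x. 2 * (f x \<bullet> f' x))\<bar> \<le> 2 * J" for a b
  proof -
    have "norm (integral {a..b} (\<lambda>x. f x \<bullet> f' x)) \<le> integral {a..b} (\<lambda>x. \<bar>f x \<bullet> f' x\<bar>)"
      by (rule integral_norm_bound_integral)
         (auto intro!: integrable_continuous_real continuous_intros cont)
    also have "\<dots> \<le> J"
      unfolding J_def
      by (rule integral_Icc_le_lborel) (auto intro!: continuous_intros cont abs)
    finally show ?thesis by simp
  qed
  have deriv: "((\<lambda>x. (norm (f x))\<^sup>2) has_vector_derivative 2 * (f x \<bullet> f' x)) (at x within A)" for x A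
    unfolding power2_norm_eq_inner
    using has_vector_derivative_at_within[OF f[of x], of A]
    unfolding has_vector_derivative_def
    by (auto intro!: derivative_eq_intros simp: inner_commute algebra_simps)
  have ftc: "((\<lambda>x. 2 * (f x \<bullet> f' x)) has_integral (norm (f b))\<^sup>2 - (norm (f a))\<^sup>2) {a..b}"
    if "a \<le> b" for a b
    by (rule fundamental_theorem_of_calculus[OF that deriv])
  have le: "\<bar>(norm (f b))\<^sup>2 - (norm (f a))\<^sup>2\<bar> \<le> 2 * J" if "a \<le> b" for a b
    using J[of a b] integral_unique[OF ftc[OF that]] by simp
  have "(norm (f x))\<^sup>2 \<le> (norm (f 0))\<^sup>2 + 2 * J" for x
    using le[of x 0] le[of 0 x] by (cases "x \<le> 0") auto
  then have "norm (f x) \<le> sqrt ((norm (f 0))\<^sup>2 + 2 * J)" for x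
    using real_le_rsqrt by blast
  then show thesis
    using that[of "sqrt ((norm (f 0))\<^sup>2 + 2 * J)"] by (simp add: J_def)
qed

subsection \<open>The Phragmen-Lindeloef bound for exponential type\<close>

lemma mult_exp_uminus_le_iff: "y * exp (- a) \<le> c \<longleftrightarrow> y \<le> c * exp a" for a c y :: real
  by (simp add: exp_minus field_simps)

lemma holomorphic_on_compose_entire:
  assumes "f holomorphic_on UNIV" "g holomorphic_on A"
  shows "(\<lambda>x. f (g x)) holomorphic_on A"
  using holomorphic_on_compose[OF assms(2), of f] holomorphic_on_subset[OF assms(1)]
  by (auto simp: o_def)

text \<open>The substitution \<open>z = s\<^sup>2\<close> replaces the quadrant by the sector \<open>0 \<le> arg s \<le> \<pi>/4\<close>. There the
  polynomial \<open>\<mu> s\<^sup>3\<close> with \<open>\<mu> = 1 - 2\<i>\<close> has real part at least \<open>|s|\<^sup>3 / 8\<close>, so that \<open>exp(-\<delta> \<mu> s\<^sup>3)\<close> beats the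
  growth \<open>exp(\<tau> |s|\<^sup>2)\<close> without any branch of a fractional power.\<close>

lemma Phragmen_Lindelof_quadrant:
  assumes hol: "f holomorphic_on UNIV"
    and growth: "\<And>z. cmod (f z) \<le> C * exp (\<tau> * cmod z)"
    and M: "0 < M"
    and real_axis: "\<And>x. 0 \<le> x \<Longrightarrow> cmod (f (of_real x)) \<le> M"
    and imag_axis: "\<And>x. 0 \<le> x \<Longrightarrow> cmod (f (\<i> * of_real x)) \<le> M"
    and z: "0 \<le> Re z" "0 \<le> Im z"
  shows "cmod (f z) \<le> M"
proof -
  define \<mu> where "\<mu> = Complex 1 (-2)"
  define S where "S R = {s. 0 \<le> Im s \<and> Im s \<le> Re s \<and> cmod s \<le> R}" for R
  have decay: "(cmod s) ^ 3 / 8 \<le> Re (\<mu> * s ^ 3)" if "0 \<le> Im s" "Im s \<le> Re s" for s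
  proof -
    define x y where "x = Re s" and "y = Im s"
    have xy: "0 \<le> y" "y \<le> x" using that by (auto simp: x_def y_def)
    \<comment> \<open>In the sector |s| is at most x + y, hence at most 2x; cubing produces the
      8.\<close>
    have "cmod s \<le> 2 * x"
      using cmod_le[of s] xy by (simp add: x_def y_def)
    then have "cmod s ^ 3 \<le> (2 * x) ^ 3"
      by (intro power_mono) auto
    then have "cmod s ^ 3 / 8 \<le> x ^ 3"
      by (simp add: power_mult_distrib)
    \<comment> \<open>Since y is at most x, both x y^2 and y^3 are at most x^2 y, so the added terms
      are at least (6 - 3 - 2) x^2 y.\<close>
    also have "x ^ 3 \<le> x ^ 3 + 6 * x\<^sup>2 * y - 3 * x * y\<^sup>2 - 2 * y ^ 3"
    proof -
      have "x * y * y \<le> x * x * y" "y * y * y \<le> x * x * y"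
        using xy by (auto intro!: mult_mono)
      moreover have "0 \<le> x * x * y"
        using xy by simp
      moreover have "x ^ 3 + 6 * x\<^sup>2 * y - 3 * x * y\<^sup>2 - 2 * y ^ 3
          = x ^ 3 + 6 * (x * x * y) - 3 * (x * y * y) - 2 * (y * y * y)"
        by (simp add: power2_eq_square power3_eq_cube)
      ultimately show ?thesis
        by linarith
    qed
    also have "\<dots> = Re (\<mu> * s ^ 3)"
      by (simp add: \<mu>_def power2_eq_square power3_eq_cube x_def y_def algebra_simps)
    finally show ?thesis .
  qed
  have key: "cmod (f (s\<^sup>2)) \<le> M * exp (\<delta> * Re (\<mu> * s ^ 3))"
    if s: "0 \<le> Im s" "Im s \<le> Re s" and \<delta>: "0 < \<delta>" for s \<delta>
  proof -
    define h where "h w = f (w\<^sup>2) * exp (- of_real \<delta> * \<mu> * w ^ 3)" for w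
    have norm_h: "cmod (h w) = cmod (f (w\<^sup>2)) * exp (- (\<delta> * Re (\<mu> * w ^ 3)))" for w
      by (simp add: h_def norm_mult mult.assoc)
    have hol_h: "h holomorphic_on A" for A
      unfolding h_def
      by (intro holomorphic_intros holomorphic_on_compose_entire[OF hol])
    \<comment> \<open>This is the bound for \<open>h\<close> on the arc of radius R; the cubic beats
      the quadratic, so a large R brings it below M.\<close>
    have "((\<lambda>R. C * exp (\<tau> * R\<^sup>2 - \<delta> * (R ^ 3 / 8))) \<longlongrightarrow> C * 0) at_top"
      using \<delta> by (intro tendsto_mult tendsto_const) real_asymp
    then have "\<forall>\<^sub>F R in at_top. C * exp (\<tau> * R\<^sup>2 - \<delta> * (R ^ 3 / 8)) < M"
      by (rule order_tendstoD(2)) (use M in simp)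
    then have "\<forall>\<^sub>F R in at_top. C * exp (\<tau> * R\<^sup>2 - \<delta> * (R ^ 3 / 8)) < M \<and> cmod s \<le> R"
      using eventually_ge_at_top[of "cmod s"] by eventually_elim auto
    then obtain R where R: "C * exp (\<tau> * R\<^sup>2 - \<delta> * (R ^ 3 / 8)) < M" "cmod s \<le> R"
      by (auto simp: eventually_at_top_linorder)
    have closed: "closed (S R)"
      unfolding S_def by (intro closed_Collect_conj closed_Collect_le continuous_intros)
    have inner: "w \<in> interior (S R)" if "0 < Im w" "Im w < Re w" "cmod w < R" for w
    proof (rule interiorI)
      show "open {w. 0 < Im w \<and> Im w < Re w \<and> cmod w < R}"
        by (intro open_Collect_conj open_Collect_less continuous_intros)
    qed (use that in \<open>auto simp: S_def\<close>)
    have "cmod (h s) \<le> M"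
    proof (rule maximum_modulus_frontier[where S = "S R" and f = h])
      show "continuous_on (closure (S R)) h"
        using hol_h by (rule holomorphic_on_imp_continuous_on)
      show "bounded (S R)"
        by (rule bounded_subset[of "cball 0 R"]) (auto simp: S_def)
      show "s \<in> S R"
        using s R by (simp add: S_def)
    next
      fix w assume w: "w \<in> frontier (S R)"
      then have "w \<in> S R" "w \<notin> interior (S R)"
        using closed by (auto simp: frontier_def)
      then have sect: "0 \<le> Im w" "Im w \<le> Re w" "cmod w \<le> R"
        and bd: "Im w = 0 \<or> Im w = Re w \<or> cmod w = R"
        using inner[of w] unfolding S_def by fastforce+
      have "0 \<le> Re (\<mu> * w ^ 3)"
        by (rule order_trans[OF _ decay]) (use sect in auto)
      then have le1: "exp (- (\<delta> * Re (\<mu> * w ^ 3))) \<le> 1"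
        using \<delta> by (simp add: mult_nonneg_nonneg)
      have *: "cmod (h w) \<le> M" if "cmod (f (w\<^sup>2)) \<le> M"
        unfolding norm_h using mult_mono[OF that le1] M by simp
      \<comment> \<open>Squaring sends the real edge to the nonnegative real axis and the diagonal
        edge to the nonnegative imaginary axis, where \<open>f\<close> is bounded by M. The arc is
        covered by the choice of R.\<close>
      from bd show "cmod (h w) \<le> M"
      proof (elim disjE)
        assume "Im w = 0"
        then have "w\<^sup>2 = of_real ((Re w)\<^sup>2)"
          by (simp add: complex_eq_iff power2_eq_square)
        then show ?thesis using real_axis[of "(Re w)\<^sup>2"] by (intro *) simp
      next
        assume "Im w = Re w"
        then have "w\<^sup>2 = \<i> * of_real (2 * (Re w)\<^sup>2)"
          by (simp add: complex_eq_iff power2_eq_square)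
        then show ?thesis using imag_axis[of "2 * (Re w)\<^sup>2"] by (intro *) simp
      next
        assume wR: "cmod w = R"
        have "cmod (h w) \<le> (C * exp (\<tau> * R\<^sup>2)) * exp (- (\<delta> * (R ^ 3 / 8)))"
          unfolding norm_h
        proof (rule mult_mono)
          show "cmod (f (w\<^sup>2)) \<le> C * exp (\<tau> * R\<^sup>2)"
            using growth[of "w\<^sup>2"] wR by (simp add: norm_power)
          then show "0 \<le> C * exp (\<tau> * R\<^sup>2)"
            by (rule order_trans[OF norm_ge_zero])
          show "exp (- (\<delta> * Re (\<mu> * w ^ 3))) \<le> exp (- (\<delta> * (R ^ 3 / 8)))"
            using decay[OF sect(1,2)] wR \<delta> by simp
        qed simp
        also have "\<dots> = C * exp (\<tau> * R\<^sup>2 - \<delta> * (R ^ 3 / 8))"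
          by (simp only: mult.assoc exp_add[symmetric] diff_conv_add_uminus)
        finally show ?thesis using R by simp
      qed
    qed (rule hol_h)
    then show ?thesis
      by (simp add: norm_h mult_exp_uminus_le_iff)
  qed
  \<comment> \<open>The principal root maps the closed first quadrant into the sector.\<close>
  define s where "s = csqrt z"
  have s: "0 \<le> Im s" "Im s \<le> Re s" "s\<^sup>2 = z"
  proof -
    show "s\<^sup>2 = z" by (simp add: s_def)
    show "0 \<le> Im s"
      using z by (auto simp: s_def sgn_if complex_Re_le_cmod)
    show "Im s \<le> Re s"
      using z by (auto simp: s_def sgn_if complex_Re_le_cmod)
  qed
  \<comment> \<open>The point s is fixed, so letting \<delta> tend to 0 removes the auxiliary
    factor.\<close>
  have "((\<lambda>\<delta>. M * exp (\<delta> * Re (\<mu> * s ^ 3))) \<longlongrightarrow> M * exp (0 * Re (\<mu> * s ^ 3))) (at_right 0)"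
    by (intro tendsto_intros)
  moreover have "\<forall>\<^sub>F \<delta> in at_right 0. cmod (f z) \<le> M * exp (\<delta> * Re (\<mu> * s ^ 3))"
    using eventually_at_right_less[of "0::real"]
    by eventually_elim (use key[OF s(1,2)] s(3) in simp)
  ultimately have "cmod (f z) \<le> M * exp (0 * Re (\<mu> * s ^ 3))"
    by (intro tendsto_lowerbound) auto
  then show ?thesis by simp
qed

text \<open>An arbitrary bound A on the half-plane improves to the bound M from the real line. The
  divisor 1 - i \<delta> z has real part at least 1 there and grows with |z|, so the maximum
  principle on a large half-disc bounds the quotient by M; then \<delta> tends to 0.\<close>

lemma maximum_modulus_half_plane:
  assumes hol: "f holomorphic_on UNIV"
    and bdd: "\<And>z. 0 \<le> Im z \<Longrightarrow> cmod (f z) \<le> A"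
    and M: "0 < M" and real_axis: "\<And>x. cmod (f (of_real x)) \<le> M"
    and z: "0 \<le> Im z"
  shows "cmod (f z) \<le> M"
proof -
  define S where "S R = {w. 0 \<le> Im w \<and> cmod w \<le> R}" for R
  have key: "cmod (f z) \<le> M * cmod (1 - \<i> * of_real \<delta> * z)" if \<delta>: "0 < \<delta>" for \<delta>
  proof -
    \<comment> \<open>Large enough that A is at most M (\<delta> R - 1), which settles the arc, and
      that z lies in the half-disc.\<close>
    define R where "R = max (cmod z) ((A + M) / (M * \<delta>))"
    define h where "h w = f w / (1 - \<i> * of_real \<delta> * w)" for w
    have Re: "1 \<le> Re (1 - \<i> * of_real \<delta> * w)" if "0 \<le> Im w" for w
      using that \<delta> by simp
    have nz: "1 - \<i> * of_real \<delta> * w \<noteq> 0" if "0 \<le> Im w" for w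
      using Re[OF that] by (metis not_one_le_zero zero_complex.simps(1))
    have sub: "S R \<subseteq> {w. 0 \<le> Im w}"
      by (auto simp: S_def)
    have hol_h: "h holomorphic_on B" if "B \<subseteq> {w. 0 \<le> Im w}" for B
      unfolding h_def
      by (intro holomorphic_intros holomorphic_on_subset[OF hol]) (use that nz in auto)
    have closed: "closed (S R)"
      unfolding S_def by (intro closed_Collect_conj closed_Collect_le continuous_intros)
    have inner: "w \<in> interior (S R)" if "0 < Im w" "cmod w < R" for w
    proof (rule interiorI)
      show "open {w. 0 < Im w \<and> cmod w < R}"
        by (intro open_Collect_conj open_Collect_less continuous_intros)
    qed (use that in \<open>auto simp: S_def\<close>)
    have "cmod (h z) \<le> M"
    proof (rule maximum_modulus_frontier[where S = "S R" and f = h])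
      show "h holomorphic_on interior (S R)"
        by (rule hol_h) (use interior_subset sub in blast)
      show "continuous_on (closure (S R)) h"
        using hol_h sub closed by (simp add: holomorphic_on_imp_continuous_on)
      show "bounded (S R)"
        by (rule bounded_subset[of "cball 0 R"]) (auto simp: S_def)
      show "z \<in> S R"
        using z by (simp add: S_def R_def)
    next
      fix w assume w: "w \<in> frontier (S R)"
      then have "w \<in> S R" "w \<notin> interior (S R)"
        using closed by (auto simp: frontier_def)
      then have Im: "0 \<le> Im w" and bd: "Im w = 0 \<or> cmod w = R"
        using inner[of w] unfolding S_def by fastforce+
      have ge1: "1 \<le> cmod (1 - \<i> * of_real \<delta> * w)"
        using Re[OF Im] complex_Re_le_cmod order_trans by blast
      from bd show "cmod (h w) \<le> M"
      proof
        assume "Im w = 0"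
        then have "w = of_real (Re w)" by (simp add: complex_eq_iff)
        then have "cmod (f w) \<le> M" using real_axis by metis
        also have "M \<le> M * cmod (1 - \<i> * of_real \<delta> * w)"
          using ge1 M by simp
        finally show ?thesis
          using ge1 nz[OF Im] by (simp add: h_def norm_divide divide_simps)
      next
        assume wR: "cmod w = R"
        have "cmod (of_real \<delta> * w) - 1 \<le> cmod (1 - \<i> * of_real \<delta> * w)"
          using norm_triangle_ineq2[of "\<i> * of_real \<delta> * w" 1]
          by (simp add: norm_mult norm_minus_commute)
        then have *: "\<delta> * R - 1 \<le> cmod (1 - \<i> * of_real \<delta> * w)"
          using \<delta> wR by (simp add: norm_mult)
        have "(A + M) / (M * \<delta>) \<le> R"
          by (simp add: R_def)
        then have "A + M \<le> M * (\<delta> * R)"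
          using M \<delta> by (simp add: field_simps)
        then have "A \<le> M * (\<delta> * R - 1)"
          by (simp add: algebra_simps)
        also have "\<dots> \<le> M * cmod (1 - \<i> * of_real \<delta> * w)"
          using * M by simp
        finally have "cmod (f w) \<le> M * cmod (1 - \<i> * of_real \<delta> * w)"
          using bdd[OF Im] by simp
        then show ?thesis
          using ge1 nz[OF Im] by (simp add: h_def norm_divide divide_simps)
      qed
    qed
    then show ?thesis
      using nz[OF z] by (simp add: h_def norm_divide divide_simps)
  qed
  have "((\<lambda>\<delta>. M * cmod (1 - \<i> * of_real \<delta> * z)) \<longlongrightarrow> M * cmod (1 - \<i> * of_real 0 * z)) (at_right 0)"
    by (intro tendsto_intros)
  moreover have "\<forall>\<^sub>F \<delta> in at_right 0. cmod (f z) \<le> M * cmod (1 - \<i> * of_real \<delta> * z)"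
    using eventually_at_right_less[of "0::real"] by eventually_elim (use key in simp)
  ultimately have "cmod (f z) \<le> M * cmod (1 - \<i> * of_real 0 * z)"
    by (intro tendsto_lowerbound) auto
  then show ?thesis by simp
qed

text \<open>The factor exp(i (\<tau> + \<epsilon>) z) has modulus 1 on the real line and cancels the
  growth up the imaginary axis. Two quadrants then give some bound on the half-plane, which
  \<open>maximum_modulus_half_plane\<close> sharpens to M before \<epsilon> tends to 0.\<close>

lemma exp_type_upper_half_plane_bound:
  assumes hol: "F holomorphic_on UNIV" and type: "exp_type_at_most \<tau> F"
    and M: "0 < M" and real_axis: "\<And>x. cmod (F (of_real x)) \<le> M"
    and z: "0 \<le> Im z"
  shows "cmod (F z) \<le> M * exp (\<tau> * Im z)"
proof -
  have key: "cmod (F z) \<le> M * exp ((\<tau> + \<epsilon>) * Im z)" if \<epsilon>: "0 < \<epsilon>" for \<epsilon>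
  proof -
    obtain C where C: "0 < C" "\<And>w. cmod (F w) \<le> C * exp ((\<tau> + \<epsilon>) * cmod w)"
      using type \<epsilon> unfolding exp_type_at_most_def by blast
    define f where "f w = F w * exp (\<i> * of_real (\<tau> + \<epsilon>) * w)" for w
    have norm_f: "cmod (f w) = cmod (F w) * exp (- ((\<tau> + \<epsilon>) * Im w))" for w
      by (simp add: f_def norm_mult algebra_simps)
    have hol_f: "f holomorphic_on UNIV"
      unfolding f_def by (intro holomorphic_intros hol)
    have real_f: "cmod (f (of_real x)) \<le> max M C" for x
      using real_axis[of x] by (simp add: norm_f)
    have imag_f: "cmod (f (\<i> * of_real x)) \<le> max M C" if "0 \<le> x" for x
      using C(2)[of "\<i> * of_real x"] that
      by (simp add: norm_f norm_mult mult_exp_uminus_le_iff le_max_iff_disj)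
    \<comment> \<open>A crude exponential bound suffices: the quadrant lemma accepts any exponential
      rate.\<close>
    have growth: "cmod (f w) \<le> C * exp (2 * \<bar>\<tau> + \<epsilon>\<bar> * cmod w)" for w
    proof -
      have "(\<tau> + \<epsilon>) * cmod w + - ((\<tau> + \<epsilon>) * Im w) \<le> \<bar>\<tau> + \<epsilon>\<bar> * cmod w + \<bar>\<tau> + \<epsilon>\<bar> * cmod w"
      proof (rule add_mono)
        show "(\<tau> + \<epsilon>) * cmod w \<le> \<bar>\<tau> + \<epsilon>\<bar> * cmod w"
          by (intro mult_right_mono) auto
        have "- ((\<tau> + \<epsilon>) * Im w) \<le> \<bar>\<tau> + \<epsilon>\<bar> * \<bar>Im w\<bar>"
          by (metis abs_ge_minus_self abs_mult)
        also have "\<dots> \<le> \<bar>\<tau> + \<epsilon>\<bar> * cmod w"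
          by (intro mult_left_mono abs_Im_le_cmod) auto
        finally show "- ((\<tau> + \<epsilon>) * Im w) \<le> \<bar>\<tau> + \<epsilon>\<bar> * cmod w" .
      qed
      then have *: "exp ((\<tau> + \<epsilon>) * cmod w + - ((\<tau> + \<epsilon>) * Im w)) \<le> exp (2 * \<bar>\<tau> + \<epsilon>\<bar> * cmod w)"
        by (simp add: mult.commute)
      have "cmod (f w) \<le> C * exp ((\<tau> + \<epsilon>) * cmod w) * exp (- ((\<tau> + \<epsilon>) * Im w))"
        unfolding norm_f by (intro mult_right_mono C(2)) simp
      also have "\<dots> = C * exp ((\<tau> + \<epsilon>) * cmod w + - ((\<tau> + \<epsilon>) * Im w))"
        by (simp only: exp_add mult.assoc)
      also have "\<dots> \<le> C * exp (2 * \<bar>\<tau> + \<epsilon>\<bar> * cmod w)"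
        using * C(1) by simp
      finally show ?thesis .
    qed
    have pos: "0 < max M C" using M by simp
    have Q1: "cmod (f w) \<le> max M C" if "0 \<le> Re w" "0 \<le> Im w" for w
      by (rule Phragmen_Lindelof_quadrant[OF hol_f growth pos real_f imag_f that])
    \<comment> \<open>Rotation by i carries the first quadrant onto the second.\<close>
    have Q2: "cmod (f (\<i> * w)) \<le> max M C" if "0 \<le> Re w" "0 \<le> Im w" for w
    proof (rule Phragmen_Lindelof_quadrant[OF _ _ pos _ _ that, where f = "\<lambda>w. f (\<i> * w)"])
      show "(\<lambda>w. f (\<i> * w)) holomorphic_on UNIV"
        by (intro holomorphic_on_compose_entire[OF hol_f] holomorphic_intros)
      show "cmod (f (\<i> * w)) \<le> C * exp (2 * \<bar>\<tau> + \<epsilon>\<bar> * cmod w)" for w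
        using growth[of "\<i> * w"] by (simp add: norm_mult)
      show "cmod (f (\<i> * (\<i> * of_real x))) \<le> max M C" for x
        using real_f[of "-x"] by (simp add: mult.assoc[symmetric])
    qed (use imag_f in auto)
    have bdd: "cmod (f w) \<le> max M C" if "0 \<le> Im w" for w
    proof (cases "0 \<le> Re w")
      case False
      then show ?thesis using Q2[of "- \<i> * w"] that by (simp add: mult.assoc[symmetric])
    qed (use Q1 that in auto)
    have "cmod (f z) \<le> M"
      by (rule maximum_modulus_half_plane[OF hol_f bdd M _ z])
         (use real_axis in \<open>simp_all add: norm_f\<close>)
    then show ?thesis
      by (simp add: norm_f mult_exp_uminus_le_iff)
  qed
  have "((\<lambda>\<epsilon>. M * exp ((\<tau> + \<epsilon>) * Im z)) \<longlongrightarrow> M * exp ((\<tau> + 0) * Im z)) (at_right 0)"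
    by (intro tendsto_intros)
  moreover have "\<forall>\<^sub>F \<epsilon> in at_right 0. cmod (F z) \<le> M * exp ((\<tau> + \<epsilon>) * Im z)"
    using eventually_at_right_less[of "0::real"] by eventually_elim (use key in simp)
  ultimately have "cmod (F z) \<le> M * exp ((\<tau> + 0) * Im z)"
    by (intro tendsto_lowerbound) auto
  then show ?thesis by simp
qed

text \<open>The lower half-plane is reached by z -> -z. The slack \<eta> provides the strictly
  positive bound that the half-plane version asks for, since M may be 0.\<close>

theorem exp_type_bound:
  assumes hol: "F holomorphic_on UNIV" and type: "exp_type_at_most \<tau> F"
    and real_axis: "\<And>x. cmod (F (of_real x)) \<le> M"
  shows "cmod (F z) \<le> M * exp (\<tau> * \<bar>Im z\<bar>)"
proof -
  have "0 \<le> M" using real_axis[of 0] order_trans[OF norm_ge_zero] by blast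
  have key: "cmod (F z) \<le> (M + \<eta>) * exp (\<tau> * \<bar>Im z\<bar>)" if \<eta>: "0 < \<eta>" for \<eta>
  proof (cases "0 \<le> Im z")
    case True
    have "cmod (F (of_real x)) \<le> M + \<eta>" for x
      using real_axis[of x] \<eta> by simp
    then show ?thesis
      using exp_type_upper_half_plane_bound[OF hol type, of "M + \<eta>" z] \<eta> \<open>0 \<le> M\<close> True by simp
  next
    case False
    have "cmod (F (- (- z))) \<le> (M + \<eta>) * exp (\<tau> * Im (- z))"
    proof (rule exp_type_upper_half_plane_bound[where F = "\<lambda>w. F (- w)"])
      show "(\<lambda>w. F (- w)) holomorphic_on UNIV"
        by (intro holomorphic_on_compose_entire[OF hol] holomorphic_intros)
      show "exp_type_at_most \<tau> (\<lambda>w. F (- w))"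
        using type unfolding exp_type_at_most_def by (metis norm_minus_cancel)
      show "cmod (F (- of_real x)) \<le> M + \<eta>" for x
        using real_axis[of "-x"] \<eta> by simp
    qed (use \<eta> \<open>0 \<le> M\<close> False in auto)
    then show ?thesis using False by simp
  qed
  have "((\<lambda>\<eta>. (M + \<eta>) * exp (\<tau> * \<bar>Im z\<bar>)) \<longlongrightarrow> (M + 0) * exp (\<tau> * \<bar>Im z\<bar>)) (at_right 0)"
    by (intro tendsto_intros)
  moreover have "\<forall>\<^sub>F \<eta> in at_right 0. cmod (F z) \<le> (M + \<eta>) * exp (\<tau> * \<bar>Im z\<bar>)"
    using eventually_at_right_less[of "0::real"] by eventually_elim (use key in simp)
  ultimately have "cmod (F z) \<le> (M + 0) * exp (\<tau> * \<bar>Im z\<bar>)"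
    by (intro tendsto_lowerbound) auto
  then show ?thesis by simp
qed

text \<open>Cauchy's estimate on the circle of radius R about 0, where |Im w| is at most R. The
  radius stays free and is optimized later.\<close>

lemma exp_type_higher_deriv_bound:
  assumes hol: "F holomorphic_on UNIV" and type: "exp_type_at_most \<tau> F"
    and real_axis: "\<And>x. cmod (F (of_real x)) \<le> M"
    and "0 \<le> \<tau>" "0 < R"
  shows "cmod ((deriv ^^ n) F 0) \<le> fact n * (M * exp (\<tau> * R)) / R ^ n"
proof (rule Cauchy_inequality)
  show "cmod (F w) \<le> M * exp (\<tau> * R)" if "cmod (0 - w) = R" for w
  proof -
    have "0 \<le> M" using real_axis[of 0] order_trans[OF norm_ge_zero] by blast
    have "\<bar>Im w\<bar> \<le> R" using that abs_Im_le_cmod[of w] by simp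
    then have "M * exp (\<tau> * \<bar>Im w\<bar>) \<le> M * exp (\<tau> * R)"
      using \<open>0 \<le> \<tau>\<close> \<open>0 \<le> M\<close> by (intro mult_left_mono) (auto intro!: mult_left_mono)
    then show ?thesis
      using exp_type_bound[OF hol type real_axis, of w] by simp
  qed
qed (use assms holomorphic_on_subset holomorphic_on_imp_continuous_on in auto)

subsection \<open>The Bernstein inequality on the Paley-Wiener space\<close>

abbreviation (input) on_reals :: "(complex \<Rightarrow> complex) \<Rightarrow> real \<Rightarrow> complex" where
  "on_reals f \<equiv> (\<lambda>x. f (complex_of_real x))"

lemma continuous_on_entire:
  assumes "f holomorphic_on UNIV"
  shows "continuous_on A f"
  using holomorphic_on_imp_continuous_on[OF assms] continuous_on_subset by blast

lemma continuous_on_compose_entire: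
  assumes "f holomorphic_on UNIV" "continuous_on A p"
  shows "continuous_on A (\<lambda>x. f (p x))"
  using continuous_on_compose2[OF continuous_on_entire[OF assms(1)] assms(2)] by blast

lemma continuous_on_on_reals: "f holomorphic_on UNIV \<Longrightarrow> continuous_on A (on_reals f)"
  by (rule continuous_on_compose_entire) (auto intro!: continuous_intros)

lemma PW2_iff_L2:
  "g \<in> PW2 \<longleftrightarrow> g holomorphic_on UNIV \<and> exp_type_at_most pi g \<and> L2 (on_reals g)"
  by (auto simp: PW2_def L2_def continuous_on_on_reals)

lemma has_field_derivative_entire:
  "f holomorphic_on UNIV \<Longrightarrow> (f has_field_derivative deriv f z) (at z)"
  by (rule holomorphic_derivI[where S = UNIV]) auto

lemma on_reals_has_vector_derivative:
  "f holomorphic_on UNIV \<Longrightarrow> (on_reals f has_vector_derivative on_reals (deriv f) x) (at x)"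
  by (rule has_vector_derivative_real_field) (rule has_field_derivative_entire)

text \<open>Cauchy's estimate on unit circles costs only the constant factor exp(\<tau> +
  \<epsilon>).\<close>

lemma exp_type_deriv:
  assumes hol: "g holomorphic_on UNIV" and type: "exp_type_at_most \<tau> g" and \<tau>: "0 \<le> \<tau>"
  shows "exp_type_at_most \<tau> (deriv g)"
  unfolding exp_type_at_most_def
proof (intro allI impI)
  fix \<epsilon> :: real assume \<epsilon>: "0 < \<epsilon>"
  then obtain C where C: "0 < C" "\<And>z. cmod (g z) \<le> C * exp ((\<tau> + \<epsilon>) * cmod z)"
    using type unfolding exp_type_at_most_def by blast
  have "cmod (deriv g z) \<le> (C * exp (\<tau> + \<epsilon>)) * exp ((\<tau> + \<epsilon>) * cmod z)" for z
  proof -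
    have "cmod ((deriv ^^ 1) g z) \<le> fact 1 * (C * exp ((\<tau> + \<epsilon>) * (cmod z + 1))) / 1 ^ 1"
    proof (rule Cauchy_inequality)
      fix w assume "cmod (z - w) = 1"
      then have "cmod w \<le> cmod z + 1"
        by (metis norm_triangle_sub norm_minus_commute)
      then have "(\<tau> + \<epsilon>) * cmod w \<le> (\<tau> + \<epsilon>) * (cmod z + 1)"
        using \<tau> \<epsilon> by (intro mult_left_mono) auto
      then show "cmod (g w) \<le> C * exp ((\<tau> + \<epsilon>) * (cmod z + 1))"
        using C(1) by (intro order_trans[OF C(2)] mult_left_mono) auto
    qed (use hol holomorphic_on_subset continuous_on_entire in auto)
    also have "fact 1 * (C * exp ((\<tau> + \<epsilon>) * (cmod z + 1))) / 1 ^ 1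
        = (C * exp (\<tau> + \<epsilon>)) * exp ((\<tau> + \<epsilon>) * cmod z)"
      by (simp add: exp_add[symmetric] algebra_simps)
    finally show ?thesis by simp
  qed
  then show "\<exists>C>0. \<forall>z. cmod (deriv g z) \<le> C * exp ((\<tau> + \<epsilon>) * cmod z)"
    using C(1) by (intro exI[of _ "C * exp (\<tau> + \<epsilon>)"]) simp
qed

lemma holomorphic_higher_deriv_entire:
  "g holomorphic_on UNIV \<Longrightarrow> (deriv ^^ k) g holomorphic_on UNIV"
  by (rule holomorphic_higher_deriv) auto

section \<open>Correlation with a truncated test function\<close>

text \<open>A truncated correlation of \<open>g\<close> with \<open>h\<close>. It is entire of the
  same type as \<open>g\<close>, bounded on the real line by square norms, and its value at 0 is a
  truncated pairing of \<open>g\<close> with the conjugate of \<open>h\<close>.\<close>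

definition smear :: "real \<Rightarrow> (real \<Rightarrow> complex) \<Rightarrow> (complex \<Rightarrow> complex) \<Rightarrow> complex \<Rightarrow> complex" where
  "smear N h g z = integral {-N..N} (\<lambda>t. g (z + of_real t) * h t)"

lemma smear_integrand_continuous:
  assumes "g holomorphic_on UNIV" "continuous_on UNIV h"
  shows "continuous_on A (\<lambda>t. g (z + of_real t) * h t)"
  by (intro continuous_on_mult continuous_on_compose_entire[OF assms(1)]
      continuous_on_subset[OF assms(2)] continuous_intros) auto

text \<open>The translation sits in the argument of \<open>g\<close>, so derivatives fall on
  \<open>g\<close> and continuity of \<open>h\<close> is enough.\<close>

lemma smear_has_field_derivative:
  assumes hol: "g holomorphic_on UNIV" and h: "continuous_on UNIV h"
  shows "(smear N h g has_field_derivative smear N h (deriv g) z) (at z)"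
proof -
  have "((\<lambda>z. integral (cbox (-N) N) (\<lambda>t. g (z + of_real t) * h t)) has_field_derivative
      integral (cbox (-N) N) (\<lambda>t. deriv g (z + of_real t) * h t)) (at z within UNIV)"
  proof (rule leibniz_rule_field_derivative)
    show "((\<lambda>z. g (z + of_real t) * h t) has_field_derivative deriv g (w + of_real t) * h t)
        (at w within UNIV)" for w t
      by (intro DERIV_cmult_right DERIV_shift[THEN iffD1] has_field_derivative_entire[OF hol])
    show "(\<lambda>t. g (w + of_real t) * h t) integrable_on cbox (-N) N" for w
      by (intro integrable_continuous smear_integrand_continuous[OF hol h])
    have "continuous_on (UNIV \<times> cbox (-N) N) (\<lambda>p. deriv g (fst p + of_real (snd p)) * h (snd p))"
      by (intro continuous_on_mult continuous_on_compose_entire[OF holomorphic_deriv[OF hol]]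
          continuous_on_compose2[OF h] continuous_intros) auto
    then show "continuous_on (UNIV \<times> cbox (-N) N) (\<lambda>(z, t). deriv g (z + of_real t) * h t)"
      by (simp add: case_prod_unfold)
  qed auto
  then show ?thesis
    by (simp add: smear_def [abs_def])
qed

lemma smear_higher_deriv:
  assumes hol: "g holomorphic_on UNIV" and h: "continuous_on UNIV h"
  shows "(deriv ^^ k) (smear N h g) = smear N h ((deriv ^^ k) g)"
proof (induction k)
  case (Suc k)
  have "deriv (smear N h ((deriv ^^ k) g)) z = smear N h (deriv ((deriv ^^ k) g)) z" for z
    by (intro DERIV_imp_deriv smear_has_field_derivative holomorphic_higher_deriv_entire hol h)
  then show ?case using Suc by auto
qed auto

lemma smear_exp_type:
  assumes hol: "g holomorphic_on UNIV" and h: "continuous_on UNIV h"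
    and type: "exp_type_at_most \<tau> g" and \<tau>: "0 \<le> \<tau>"
  shows "exp_type_at_most \<tau> (smear N h g)"
  unfolding exp_type_at_most_def
proof (intro allI impI)
  fix \<epsilon> :: real assume \<epsilon>: "0 < \<epsilon>"
  then obtain C where C: "0 < C" "\<And>z. cmod (g z) \<le> C * exp ((\<tau> + \<epsilon>) * cmod z)"
    using type unfolding exp_type_at_most_def by blast
  define I where "I = integral {-N..N} (\<lambda>t. cmod (h t))"
  have h': "continuous_on A h" for A using h continuous_on_subset by blast
  have "0 \<le> I" unfolding I_def
    by (intro integral_nonneg integrable_continuous_real continuous_intros h') auto
  define D where "D = C * exp ((\<tau> + \<epsilon>) * N)"
  have "0 < D" using C by (simp add: D_def)
  \<comment> \<open>I + 1 in place of I keeps the constant positive even when \<open>h\<close>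
    vanishes; D absorbs the cost of translating by at most N.\<close>
  have "cmod (smear N h g z) \<le> (D * (I + 1)) * exp ((\<tau> + \<epsilon>) * cmod z)" for z
  proof -
    have "cmod (smear N h g z)
        \<le> integral {-N..N} (\<lambda>t. (D * exp ((\<tau> + \<epsilon>) * cmod z)) * cmod (h t))"
      unfolding smear_def
    proof (rule integral_norm_bound_integral)
      fix t assume t: "t \<in> {-N..N}"
      have "cmod (z + of_real t) \<le> cmod z + N"
        using t by (intro order_trans[OF norm_triangle_ineq]) auto
      then have "(\<tau> + \<epsilon>) * cmod (z + of_real t) \<le> (\<tau> + \<epsilon>) * (cmod z + N)"
        using \<tau> \<epsilon> by (intro mult_left_mono) auto
      then have "cmod (g (z + of_real t)) \<le> C * exp ((\<tau> + \<epsilon>) * (cmod z + N))"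
        using C(1) by (intro order_trans[OF C(2)] mult_left_mono) auto
      also have "\<dots> = D * exp ((\<tau> + \<epsilon>) * cmod z)"
        by (simp add: D_def exp_add[symmetric] algebra_simps)
      finally show "norm (g (z + of_real t) * h t) \<le> (D * exp ((\<tau> + \<epsilon>) * cmod z)) * cmod (h t)"
        by (simp add: norm_mult mult_right_mono)
    qed (intro integrable_continuous_real smear_integrand_continuous hol h continuous_intros h')+
    also have "\<dots> = (D * exp ((\<tau> + \<epsilon>) * cmod z)) * I"
      by (simp add: I_def)
    also have "\<dots> \<le> (D * exp ((\<tau> + \<epsilon>) * cmod z)) * (I + 1)"
      using \<open>0 < D\<close> by (intro mult_left_mono) auto
    finally show ?thesis by (simp add: mult_ac)
  qed
  then show "\<exists>C>0. \<forall>z. cmod (smear N h g z) \<le> C * exp ((\<tau> + \<epsilon>) * cmod z)"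
    using \<open>0 < D\<close> \<open>0 \<le> I\<close> by (intro exI[of _ "D * (I + 1)"]) simp
qed

text \<open>Young's inequality u v <= (c u^2 + v^2 / c) / 2 under the integral, with translation
  invariance making the bound independent of x. The weight c is chosen in the application.\<close>

lemma smear_bound_reals:
  assumes hol: "g holomorphic_on UNIV" and h: "continuous_on UNIV h"
    and L2: "L2 (on_reals g)" and c: "0 < c"
  shows "cmod (smear N h g (of_real x))
    \<le> (c * L2_sqnorm (on_reals g) + integral {-N..N} (\<lambda>t. (cmod (h t))\<^sup>2) / c) / 2"
proof -
  have h': "continuous_on A h" for A using h continuous_on_subset by blast
  have cont: "continuous_on A (\<lambda>t. g (of_real x + of_real t))" for A
    by (intro continuous_on_compose_entire[OF hol] continuous_intros)
  have int: "integrable lborel (\<lambda>t. (cmod (g (of_real x + of_real t)))\<^sup>2)"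
    using lborel_integrable_real_affine[OF L2_norm2_integrable[OF L2], of 1 x] by simp
  have eq: "(\<integral>t. (cmod (g (of_real x + of_real t)))\<^sup>2 \<partial>lborel) = L2_sqnorm (on_reals g)"
    using lborel_integral_real_affine[of 1 "\<lambda>t. (cmod (g (of_real t)))\<^sup>2" x]
    by (simp add: L2_sqnorm_def)
  have "cmod (smear N h g (of_real x))
      \<le> integral {-N..N} (\<lambda>t. c / 2 * (cmod (g (of_real x + of_real t)))\<^sup>2 + 1 / (2 * c) * (cmod (h t))\<^sup>2)"
    unfolding smear_def
  proof (rule integral_norm_bound_integral)
    fix t
    define u v where "u = cmod (g (of_real x + of_real t))" and "v = cmod (h t)"
    have "0 \<le> (c * u - v)\<^sup>2 / (2 * c)"
      using c by simp
    also have "\<dots> = c / 2 * u\<^sup>2 + 1 / (2 * c) * v\<^sup>2 - u * v"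
      using c by (simp add: power2_eq_square field_simps)
    finally show "norm (g (of_real x + of_real t) * h t)
        \<le> c / 2 * (cmod (g (of_real x + of_real t)))\<^sup>2 + 1 / (2 * c) * (cmod (h t))\<^sup>2"
      by (simp add: norm_mult u_def v_def)
  qed (intro integrable_continuous_real smear_integrand_continuous hol h continuous_intros h' cont)+
  also have "\<dots> = c / 2 * integral {-N..N} (\<lambda>t. (cmod (g (of_real x + of_real t)))\<^sup>2)
      + 1 / (2 * c) * integral {-N..N} (\<lambda>t. (cmod (h t))\<^sup>2)"
    using c by (subst integral_add)
       (auto intro!: integrable_continuous_real continuous_intros h' cont)
  also have "\<dots> \<le> c / 2 * L2_sqnorm (on_reals g) + 1 / (2 * c) * integral {-N..N} (\<lambda>t. (cmod (h t))\<^sup>2)"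
    unfolding eq[symmetric] using c
    by (intro add_right_mono mult_left_mono integral_Icc_le_lborel int continuous_intros cont) auto
  finally show ?thesis by (simp add: add_divide_distrib)
qed

text \<open>Testing the derivative against its own truncation turns the pointwise Cauchy estimate for
  bounded functions into one for the square norm.\<close>

lemma PW2_higher_deriv_L2:
  assumes g: "g \<in> PW2" and R: "0 < R"
  shows "L2 (on_reals ((deriv ^^ k) g))"
    and "L2_sqnorm (on_reals ((deriv ^^ k) g)) \<le> (fact k * exp (pi * R) / R ^ k)\<^sup>2 * L2_sqnorm (on_reals g)"
proof -
  have hol: "g holomorphic_on UNIV" and type: "exp_type_at_most pi g" and L2: "L2 (on_reals g)"
    using g by (auto simp: PW2_iff_L2)
  define d where "d = (deriv ^^ k) g"
  have hol_d: "d holomorphic_on UNIV"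
    unfolding d_def by (rule holomorphic_higher_deriv_entire[OF hol])
  define A where "A = fact k * exp (pi * R) / R ^ k"
  have "0 < A" using R by (simp add: A_def)
  have scale: "fact k * (B * exp (pi * R)) / R ^ k = A * B" for B
    by (simp add: A_def)
  define h where "h t = cnj (d (of_real t))" for t :: real
  have h: "continuous_on UNIV h"
    unfolding h_def by (intro continuous_on_cnj continuous_on_on_reals hol_d)
  have cont: "continuous_on B (\<lambda>t. (cmod (on_reals d t))\<^sup>2)" for B
    by (intro continuous_intros continuous_on_on_reals hol_d)
  have bound: "integral {-N..N} (\<lambda>t. (cmod (on_reals d t))\<^sup>2) \<le> A\<^sup>2 * L2_sqnorm (on_reals g)" for N
  proof -
    define H where "H = integral {-N..N} (\<lambda>t. (cmod (on_reals d t))\<^sup>2)"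
    have hol_s: "smear N h g holomorphic_on UNIV"
      using smear_has_field_derivative[OF hol h] by (auto simp: holomorphic_on_open)
    have "cmod ((deriv ^^ k) (smear N h g) 0)
        \<le> fact k * ((A * L2_sqnorm (on_reals g) + H / A) / 2 * exp (pi * R)) / R ^ k"
    proof (rule exp_type_higher_deriv_bound[OF hol_s smear_exp_type[OF hol h type]])
      show "cmod (smear N h g (of_real x)) \<le> (A * L2_sqnorm (on_reals g) + H / A) / 2" for x
        using smear_bound_reals[OF hol h L2 \<open>0 < A\<close>, of N x] by (simp add: H_def h_def)
    qed (use R in auto)
    also have "\<dots> = A * (A * L2_sqnorm (on_reals g) + H / A) / 2"
      by (simp add: scale)
    \<comment> \<open>The Young weight A equals the Cauchy constant, so H returns with factor 1/2
      and can be absorbed into the left-hand side.\<close>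
    also have "\<dots> = (A\<^sup>2 * L2_sqnorm (on_reals g) + H) / 2"
      using \<open>0 < A\<close> by (simp add: power2_eq_square field_simps)
    \<comment> \<open>As \<open>h\<close> is the conjugate of the derivative, this value is the
      truncated square norm H itself.\<close>
    also have "(deriv ^^ k) (smear N h g) 0 = integral {-N..N} (\<lambda>t. of_real ((cmod (on_reals d t))\<^sup>2))"
      unfolding smear_higher_deriv[OF hol h] smear_def h_def d_def[symmetric]
      by (simp only: complex_norm_square add_0_left)
    also have "\<dots> = of_real H"
      unfolding H_def
      by (intro integral_unique has_integral_of_real integrable_integral
          integrable_continuous_real cont)
    finally show ?thesis by (simp add: H_def)
  qed
  have "integrable lborel (\<lambda>t. (cmod (on_reals d t))\<^sup>2)" "L2_sqnorm (on_reals d) \<le> A\<^sup>2 * L2_sqnorm (on_reals g)"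
    using integrable_lborel_if_bounded_on_Icc[OF cont _ bound] by (auto simp: L2_sqnorm_def)
  then show "L2 (on_reals ((deriv ^^ k) g))"
    and "L2_sqnorm (on_reals ((deriv ^^ k) g)) \<le> (fact k * exp (pi * R) / R ^ k)\<^sup>2 * L2_sqnorm (on_reals g)"
    using continuous_on_on_reals[OF hol_d] by (simp_all add: L2_def d_def A_def)
qed

text \<open>Log-convexity gives \<open>u k \<ge> r\<^bsup>2k\<^esup> u 0\<close> with \<open>r\<^sup>2 = u 1 / u 0\<close>. Hence \<open>(r R)\<^sup>k / k! \<le> e\<^bsup>\<tau>R\<^esup>\<close>, and summing
  against \<open>\<theta>\<^sup>k\<close> for \<open>\<theta> < 1\<close> yields \<open>e\<^bsup>r\<theta>R\<^esup> \<le> e\<^bsup>\<tau>R\<^esup> / (1 - \<theta>)\<close> for all \<open>R\<close>, which forces \<open>r \<le> \<tau>\<close>.\<close>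

lemma log_convex_growth_ratio:
  fixes u :: "nat \<Rightarrow> real"
  assumes nonneg: "\<And>k. 0 \<le> u k"
    and log_convex: "\<And>k. (u (Suc k))\<^sup>2 \<le> u k * u (Suc (Suc k))"
    and growth: "\<And>k R. 0 < R \<Longrightarrow> u k \<le> (fact k * exp (\<tau> * R) / R ^ k)\<^sup>2 * u 0"
    and \<tau>: "0 < \<tau>"
  shows "u 1 \<le> \<tau>\<^sup>2 * u 0"
proof (cases "u 0 = 0 \<or> u 1 = 0")
  case True
  then show ?thesis
  proof
    assume "u 0 = 0"
    then show ?thesis using log_convex[of 0] by simp
  qed (use nonneg[of 0] in simp)
next
  case False
  then have pos01: "0 < u 0" "0 < u 1"
    using nonneg[of 0] nonneg[of 1] by auto
  \<comment> \<open>The ratios of consecutive terms never fall below u 1 / u 0; the claim is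
    cross-multiplied and carries the positivity it needs.\<close>
  have step: "0 < u k \<and> 0 < u (Suc k) \<and> u 1 * u k \<le> u (Suc k) * u 0" for k
  proof (induction k)
    case (Suc k)
    have "0 < (u (Suc k))\<^sup>2" using Suc by simp
    then have "0 < u k * u (Suc (Suc k))" using log_convex[of k] by linarith
    then have pos: "0 < u (Suc (Suc k))" using Suc by (simp add: zero_less_mult_iff)
    have "(u 1 * u (Suc k)) * u k = (u 1 * u k) * u (Suc k)"
      by simp
    also have "\<dots> \<le> (u (Suc k) * u 0) * u (Suc k)"
      using Suc by (intro mult_right_mono) auto
    also have "\<dots> = (u (Suc k))\<^sup>2 * u 0"
      by (simp add: power2_eq_square)
    also have "\<dots> \<le> (u k * u (Suc (Suc k))) * u 0"
      using pos01 log_convex[of k] by (intro mult_right_mono) auto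
    also have "\<dots> = (u (Suc (Suc k)) * u 0) * u k"
      by simp
    finally have "u 1 * u (Suc k) \<le> u (Suc (Suc k)) * u 0"
      using Suc by simp
    then show ?case using Suc pos by simp
  qed (use pos01 in auto)
  define r where "r = sqrt (u 1 / u 0)"
  have "0 < r" using pos01 by (simp add: r_def)
  have r2: "r\<^sup>2 = u 1 / u 0" using pos01 by (simp add: r_def)
  have lower: "(r ^ k)\<^sup>2 * u 0 \<le> u k" for k
  proof (induction k)
    case (Suc k)
    have "(r ^ Suc k)\<^sup>2 * u 0 = r\<^sup>2 * ((r ^ k)\<^sup>2 * u 0)"
      by (simp add: power_mult_distrib)
    also have "\<dots> \<le> r\<^sup>2 * u k"
      using Suc by (intro mult_left_mono) auto
    also have "\<dots> \<le> u (Suc k)"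
      unfolding r2 using step[of k] pos01 by (simp add: field_simps)
    finally show ?case .
  qed simp
  have term_bound: "(r * R) ^ k / fact k \<le> exp (\<tau> * R)" if R: "0 < R" for k R
  proof -
    have "(r ^ k)\<^sup>2 * u 0 \<le> (fact k * exp (\<tau> * R) / R ^ k)\<^sup>2 * u 0"
      using lower[of k] growth[OF R, of k] by simp
    then have "(r ^ k)\<^sup>2 \<le> (fact k * exp (\<tau> * R) / R ^ k)\<^sup>2"
      using pos01 by simp
    then have "r ^ k \<le> fact k * exp (\<tau> * R) / R ^ k"
      by (rule power2_le_imp_le) (use R in simp)
    then show ?thesis
      using R by (simp add: power_mult_distrib field_simps)
  qed
  have "r \<le> \<tau>"
  proof (rule ccontr)
    assume "\<not> r \<le> \<tau>"
    \<comment> \<open>With this choice r \<theta> is the midpoint of \<tau> and r, so it still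
      exceeds \<tau> while \<theta> < 1.\<close>
    define \<theta> where "\<theta> = (r + \<tau>) / (2 * r)"
    define d where "d = r * \<theta> - \<tau>"
    have \<theta>: "0 < \<theta>" "\<theta> < 1" and d: "0 < d"
      using \<open>0 < r\<close> \<tau> \<open>\<not> r \<le> \<tau>\<close> by (auto simp: \<theta>_def d_def field_simps)
    \<comment> \<open>Makes d R equal to 1 / (1 - \<theta>), so the inequality to be refuted reads
      exp x <= x with x = d R.\<close>
    define R where "R = 1 / (1 - \<theta>) / d"
    have "0 < R" using \<theta> d by (simp add: R_def)
    have "exp (r * R * \<theta>) \<le> exp (\<tau> * R) * (1 / (1 - \<theta>))"
    \<comment> \<open>Termwise comparison of an exponential series with a geometric one.\<close>
    proof (rule sums_le)
      show "(\<lambda>k. (r * R * \<theta>) ^ k /\<^sub>R fact k) sums exp (r * R * \<theta>)"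
        by (rule exp_converges)
      show "(\<lambda>k. exp (\<tau> * R) * \<theta> ^ k) sums (exp (\<tau> * R) * (1 / (1 - \<theta>)))"
        by (intro sums_mult geometric_sums) (use \<theta> in auto)
      show "(r * R * \<theta>) ^ k /\<^sub>R fact k \<le> exp (\<tau> * R) * \<theta> ^ k" for k
        using mult_right_mono[OF term_bound[OF \<open>0 < R\<close>, of k], of "\<theta> ^ k"] \<theta>
        by (simp add: power_mult_distrib divide_inverse mult_ac)
    qed
    moreover have "exp (r * R * \<theta>) = exp (\<tau> * R) * exp (d * R)"
      by (simp add: exp_add[symmetric] d_def algebra_simps)
    ultimately have "exp (\<tau> * R) * exp (d * R) \<le> exp (\<tau> * R) * (1 / (1 - \<theta>))"
      by (simp only:)
    then have "exp (d * R) \<le> 1 / (1 - \<theta>)"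
      by (rule mult_left_le_imp_le) simp
    moreover have "1 / (1 - \<theta>) < exp (d * R)"
    proof -
      have "1 / (1 - \<theta>) = d * R" using d by (simp add: R_def)
      then show ?thesis using exp_ge_add_one_self[of "d * R"] by linarith
    qed
    ultimately show False by simp
  qed
  then have "r\<^sup>2 \<le> \<tau>\<^sup>2"
    using \<open>0 < r\<close> by (intro power_mono) auto
  then show ?thesis
    using pos01 by (simp add: r2 field_simps)
qed

text \<open>The square norms of the derivatives are log-convex by one integration by parts and
  Cauchy-Schwarz, and \<open>PW2_higher_deriv_L2\<close> bounds their growth;
  \<open>log_convex_growth_ratio\<close> then yields the sharp constant.\<close>

theorem PW2_Bernstein:
  assumes g: "g \<in> PW2"
  shows "L2_sqnorm (on_reals (deriv g)) \<le> pi\<^sup>2 * L2_sqnorm (on_reals g)"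
proof -
  have hol: "g holomorphic_on UNIV" using g by (simp add: PW2_iff_L2)
  note L2 = PW2_higher_deriv_L2(1)[OF g zero_less_one]
  have deriv: "(on_reals ((deriv ^^ k) g) has_vector_derivative on_reals ((deriv ^^ Suc k) g) x) (at x)" for k x
    using on_reals_has_vector_derivative[OF holomorphic_higher_deriv_entire[OF hol]] by simp
  define u where "u k = L2_sqnorm (on_reals ((deriv ^^ k) g))" for k
  have "u 1 \<le> pi\<^sup>2 * u 0"
  proof (rule log_convex_growth_ratio)
    show "u k \<le> (fact k * exp (pi * R) / R ^ k)\<^sup>2 * u 0" if "0 < R" for k R
      using PW2_higher_deriv_L2(2)[OF g that, of k] by (simp add: u_def)
    show "(u (Suc k))\<^sup>2 \<le> u k * u (Suc (Suc k))" for k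
    proof -
      have "u (Suc k) = L2_inner (on_reals ((deriv ^^ Suc k) g)) (on_reals ((deriv ^^ Suc k) g))"
        by (simp add: u_def L2_sqnorm_def L2_inner_def power2_norm_eq_inner)
      also have "\<dots> = - L2_inner (on_reals ((deriv ^^ k) g)) (on_reals ((deriv ^^ Suc (Suc k)) g))"
        by (rule L2_inner_parts[OF deriv deriv L2 L2 L2 L2])
      finally show ?thesis
        using L2_inner_Cauchy_Schwarz[OF L2 L2, of k "Suc (Suc k)"] by (simp add: u_def)
    qed
  qed (auto simp: u_def L2_sqnorm_nonneg)
  then show ?thesis by (simp add: u_def)
qed

lemma PW2_deriv:
  assumes g: "g \<in> PW2"
  shows "deriv g \<in> PW2"
  using g PW2_higher_deriv_L2(1)[OF g zero_less_one, of 1]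
  by (auto simp: PW2_iff_L2 exp_type_deriv intro: holomorphic_deriv)

subsection \<open>The sinc kernel\<close>

text \<open>A contour shift expressed through a primitive P of the integrand: the increment of P
  from -R to R is split at the corners of a rectangle in the upper half-plane, and each piece is
  bounded by the mean value inequality.\<close>

lemma oscillatory_integral_tendsto_0:
  assumes hol: "q holomorphic_on UNIV"
    and bound: "\<And>z. z \<noteq> 0 \<Longrightarrow> cmod (q z) \<le> M * exp (\<tau> * \<bar>Im z\<bar>) / cmod z"
    and \<sigma>: "\<tau> < \<sigma>"
  shows "((\<lambda>R. integral {-R..R} (\<lambda>x. q (of_real x) * exp (\<i> * of_real (\<sigma> * x)))) \<longlongrightarrow> 0) at_top"
proof -
  define f where "f z = q z * exp (\<i> * of_real \<sigma> * z)" for z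
  have "0 \<le> M"
    using order_trans[OF norm_ge_zero bound[of 1]] by (simp add: zero_le_mult_iff)
  have "f holomorphic_on UNIV"
    unfolding f_def by (intro holomorphic_intros hol)
  then obtain P where P: "\<And>z. (P has_field_derivative f z) (at z)"
    using holomorphic_convex_primitive'[of UNIV f] by auto
  have f_bound: "cmod (f z) \<le> M * exp (- ((\<sigma> - \<tau>) * Im z)) / cmod z" if "z \<noteq> 0" "0 \<le> Im z" for z
  proof -
    have "cmod (f z) = cmod (q z) * exp (- (\<sigma> * Im z))"
      by (simp add: f_def norm_mult)
    also have "\<dots> \<le> (M * exp (\<tau> * \<bar>Im z\<bar>) / cmod z) * exp (- (\<sigma> * Im z))"
      using bound[OF that(1)] by (rule mult_right_mono) simp
    also have "\<dots> = M * (exp (\<tau> * Im z) * exp (- (\<sigma> * Im z))) / cmod z"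
      using that by simp
    also have "exp (\<tau> * Im z) * exp (- (\<sigma> * Im z)) = exp (- ((\<sigma> - \<tau>) * Im z))"
      by (simp add: exp_add[symmetric] algebra_simps)
    finally show ?thesis .
  qed
  \<comment> \<open>A side lying in a convex set at distance at least r from 0 and height at least b
    costs the maximum of |f| times its length.\<close>
  have le: "cmod (P y - P x) \<le> M * exp (- ((\<sigma> - \<tau>) * b)) / r * cmod (y - x)"
    if "convex S" "x \<in> S" "y \<in> S" and r: "0 < r" and b: "0 \<le> b"
      and S: "\<And>z. z \<in> S \<Longrightarrow> r \<le> cmod z \<and> b \<le> Im z" for S x y r b
  proof (rule field_differentiable_bound[OF that(1) _ _ that(3,2)])
    show "(P has_field_derivative f z) (at z within S)" for z
      using P by (rule has_field_derivative_at_within)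
    fix z assume "z \<in> S"
    with S have z: "r \<le> cmod z" "b \<le> Im z" by auto
    have "cmod (f z) \<le> M * exp (- ((\<sigma> - \<tau>) * Im z)) / cmod z"
      using z r b by (intro f_bound) auto
    also have "\<dots> \<le> M * exp (- ((\<sigma> - \<tau>) * b)) / r"
      using z r \<open>0 \<le> M\<close> \<sigma> by (intro frac_le mult_left_mono mult_nonneg_nonneg) auto
    finally show "cmod (f z) \<le> M * exp (- ((\<sigma> - \<tau>) * b)) / r" .
  qed
  \<comment> \<open>The height sqrt R balances the sides: each vertical one contributes M / sqrt R,
    while the top decays like exp(-(\<sigma> - \<tau>) sqrt R) up to powers of R.\<close>
  define B where "B R = 2 * (M / R * sqrt R) + M * exp (- ((\<sigma> - \<tau>) * sqrt R)) / sqrt R * (2 * R)" for R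
  show ?thesis
  proof (rule Lim_null_comparison)
    show "\<forall>\<^sub>F R in at_top. norm (integral {-R..R} (\<lambda>x. q (of_real x) * exp (\<i> * of_real (\<sigma> * x)))) \<le> B R"
      using eventually_gt_at_top[of 0]
    proof eventually_elim
      case (elim R)
      have "((\<lambda>x. f (of_real x)) has_integral (P (of_real R) - P (of_real (-R)))) {-R..R}"
        using elim
        by (intro fundamental_theorem_of_calculus has_vector_derivative_real_field P) auto
      then have eq: "integral {-R..R} (\<lambda>x. q (of_real x) * exp (\<i> * of_real (\<sigma> * x)))
          = P (of_real R) - P (of_real (-R))"
        by (simp add: f_def integral_unique mult.assoc)
      define u v where "u = Complex (-R) (sqrt R)" and "v = Complex R (sqrt R)"
      have "cmod (P (of_real R) - P v) \<le> M * exp (- ((\<sigma> - \<tau>) * 0)) / R * cmod (of_real R - v)"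
      proof (rule le)
        show "convex ({z. Re z \<ge> R} \<inter> {z. Im z \<ge> 0})"
          by (intro convex_Int convex_halfspace_Re_ge convex_halfspace_Im_ge)
        show "R \<le> cmod z \<and> 0 \<le> Im z" if "z \<in> {z. Re z \<ge> R} \<inter> {z. Im z \<ge> 0}" for z
          using that complex_Re_le_cmod[of z] by auto
      qed (use elim in \<open>auto simp: v_def\<close>)
      moreover have "cmod (of_real R - v) = sqrt R"
        using elim by (simp add: v_def cmod_def)
      ultimately have 1: "cmod (P (of_real R) - P v) \<le> M / R * sqrt R"
        by simp
      have "cmod (P u - P (of_real (-R))) \<le> M * exp (- ((\<sigma> - \<tau>) * 0)) / R * cmod (u - of_real (-R))"
      proof (rule le)
        show "convex ({z. Re z \<le> -R} \<inter> {z. Im z \<ge> 0})"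
          by (intro convex_Int convex_halfspace_Re_le convex_halfspace_Im_ge)
        show "R \<le> cmod z \<and> 0 \<le> Im z" if "z \<in> {z. Re z \<le> -R} \<inter> {z. Im z \<ge> 0}" for z
          using that abs_Re_le_cmod[of z] by auto
      qed (use elim in \<open>auto simp: u_def\<close>)
      moreover have "cmod (u - of_real (-R)) = sqrt R"
        using elim by (simp add: u_def cmod_def)
      ultimately have 2: "cmod (P u - P (of_real (-R))) \<le> M / R * sqrt R"
        by simp
      have "cmod (P v - P u) \<le> M * exp (- ((\<sigma> - \<tau>) * sqrt R)) / sqrt R * cmod (v - u)"
      proof (rule le)
        show "convex {z. Im z \<ge> sqrt R}"
          by (rule convex_halfspace_Im_ge)
        show "sqrt R \<le> cmod z \<and> sqrt R \<le> Im z" if "z \<in> {z. Im z \<ge> sqrt R}" for z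
          using that abs_Im_le_cmod[of z] by auto
      qed (use elim in \<open>auto simp: u_def v_def\<close>)
      moreover have "cmod (v - u) = 2 * R"
        using elim by (simp add: u_def v_def cmod_def real_sqrt_mult)
      ultimately have 3: "cmod (P v - P u) \<le> M * exp (- ((\<sigma> - \<tau>) * sqrt R)) / sqrt R * (2 * R)"
        by simp
      have "P (of_real R) - P (of_real (-R))
          = (P (of_real R) - P v) + (P v - P u) + (P u - P (of_real (-R)))"
        by simp
      then have "cmod (P (of_real R) - P (of_real (-R)))
          \<le> cmod (P (of_real R) - P v) + cmod (P v - P u) + cmod (P u - P (of_real (-R)))"
        by (metis (no_types) norm_triangle_le norm_triangle_ineq add_right_mono)
      then show ?case
        unfolding eq B_def using 1 2 3 by linarith
    qed
    have "0 < \<sigma> - \<tau>" using \<sigma> by simp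
    then have "((\<lambda>R. exp (- ((\<sigma> - \<tau>) * sqrt R)) / sqrt R * (2 * R)) \<longlongrightarrow> 0) at_top"
      by real_asymp
    then have "((\<lambda>R. 2 * (M * (1 / R * sqrt R)) + M * (exp (- ((\<sigma> - \<tau>) * sqrt R)) / sqrt R * (2 * R)))
        \<longlongrightarrow> 2 * (M * 0) + M * 0) at_top"
      by (intro tendsto_intros) real_asymp
    then show "(B \<longlongrightarrow> 0) at_top"
      by (simp add: B_def [abs_def] mult.assoc)
  qed
qed

section \<open>Dirichlet kernels and point evaluation at 0\<close>

text \<open>The kernel sin(\<sigma> x) / (pi x), continued by \<sigma> / pi at 0; for \<sigma> = pi
  it is the sinc kernel of the Paley-Wiener space.\<close>

definition dirichlet :: "real \<Rightarrow> real \<Rightarrow> real" where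
  "dirichlet \<sigma> x = \<sigma> / pi * sinc (\<sigma> * x)"

lemma dirichlet_0: "dirichlet \<sigma> 0 = \<sigma> / pi"
  by (simp add: dirichlet_def)

lemma mult_dirichlet: "x * dirichlet \<sigma> x = sin (\<sigma> * x) / pi"
  by (simp add: dirichlet_def)

lemma continuous_on_dirichlet: "continuous_on A (dirichlet \<sigma>)"
  unfolding dirichlet_def [abs_def]
  by (intro continuous_intros continuous_on_compose2[OF continuous_on_sinc[OF continuous_on_id], of UNIV])
     auto

lemma dirichlet_tendsto: "((\<lambda>\<sigma>. dirichlet \<sigma> x) \<longlongrightarrow> dirichlet \<sigma>0 x) (at \<sigma>0 within A)"
proof (cases "x = 0")
  case True
  then show ?thesis by (auto simp: dirichlet_0 intro!: tendsto_intros)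
next
  case False
  then have "dirichlet \<sigma> x = sin (\<sigma> * x) / (pi * x)" for \<sigma>
    using mult_dirichlet[of x \<sigma>] by (simp add: field_simps)
  then show ?thesis using False by (auto intro!: tendsto_intros)
qed

text \<open>The constant is 4 + 1: the square of the kernel is at most 4, and its product with x^2
  at most 1. Uniformity in \<sigma> provides the dominating function for the limit \<sigma> ->
  pi.\<close>

lemma dirichlet_bound:
  assumes "0 \<le> \<sigma>" "\<sigma> \<le> 2 * pi"
  shows "(dirichlet \<sigma> x)\<^sup>2 \<le> 5 * inverse (1 + x\<^sup>2)"
proof -
  have sinc: "\<bar>sinc y\<bar> \<le> 1" for y
    using abs_sin_x_le_abs_x[of y] by (auto simp: divide_simps)
  then have "\<bar>dirichlet \<sigma> x\<bar> \<le> (\<sigma> / pi) * 1"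
    using assms unfolding dirichlet_def abs_mult by (intro mult_mono sinc) simp_all
  also have "\<dots> \<le> 2"
    using assms by (simp add: field_simps)
  finally have 1: "(dirichlet \<sigma> x)\<^sup>2 \<le> 2\<^sup>2"
    by (intro power2_le_iff_abs_le[THEN iffD2]) auto
  have "\<bar>x * dirichlet \<sigma> x\<bar> \<le> 1"
  proof -
    have "\<bar>sin (\<sigma> * x)\<bar> \<le> pi"
      using pi_gt3 abs_sin_le_one[of "\<sigma> * x"] by linarith
    then show ?thesis by (simp add: mult_dirichlet)
  qed
  then have "(x * dirichlet \<sigma> x)\<^sup>2 \<le> 1"
    by (simp add: abs_square_le_1)
  then have "(dirichlet \<sigma> x)\<^sup>2 * (1 + x\<^sup>2) \<le> 5"
    using 1 by (simp add: power_mult_distrib algebra_simps)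
  moreover have "0 < 1 + x\<^sup>2" by (simp add: add_pos_nonneg)
  ultimately show ?thesis
    by (simp add: field_simps)
qed

lemma integrable_inverse_1_plus_square_lborel: "integrable lborel (\<lambda>x::real. inverse (1 + x\<^sup>2))"
  using integrable_inverse_1_plus_square by (simp add: set_integrable_def)

text \<open>An antiderivative is Si(\<sigma> x) / pi, Si is odd, and Si tends to pi/2.\<close>

lemma integral_dirichlet_tendsto:
  assumes "0 < \<sigma>"
  shows "((\<lambda>R. integral {-R..R} (dirichlet \<sigma>)) \<longlongrightarrow> 1) at_top"
proof (rule Lim_transform_eventually)
  have "((\<lambda>R. 2 / pi * Si (\<sigma> * R)) \<longlongrightarrow> 2 / pi * (pi / 2)) at_top"
    by (intro tendsto_intros filterlim_compose[OF Si_at_top])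
       (use assms in real_asymp)
  then show "((\<lambda>R. 2 / pi * Si (\<sigma> * R)) \<longlongrightarrow> 1) at_top"
    by simp
  show "\<forall>\<^sub>F R in at_top. 2 / pi * Si (\<sigma> * R) = integral {-R..R} (dirichlet \<sigma>)"
    using eventually_ge_at_top[of 0]
  proof eventually_elim
    case (elim R)
    have "((\<lambda>x. Si (\<sigma> * x) / pi) has_vector_derivative dirichlet \<sigma> x) (at x within A)" for x A
      unfolding has_real_derivative_iff_has_vector_derivative[symmetric] dirichlet_def
      by (auto intro!: derivative_eq_intros DERIV_chain2[OF DERIV_Si])
    then have "(dirichlet \<sigma> has_integral Si (\<sigma> * R) / pi - Si (\<sigma> * (-R)) / pi) {-R..R}"
      using elim by (intro fundamental_theorem_of_calculus) auto
    moreover have "Si (\<sigma> * (-R)) = - Si (\<sigma> * R)"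
      using Si_neg[of "\<sigma> * R"] elim assms by simp
    ultimately show ?case
      by (simp add: integral_unique)
  qed
qed

text \<open>Write g(z) = g(0) + z q(z). The constant part gives g(0) by the Dirichlet integral. In
  the rest x cancels the denominator of the kernel, leaving q against the sine, a difference of two
  exponentials whose integrals vanish in the limit. The gap \<tau> < \<sigma> is what makes the
  shifted contour decay.\<close>

lemma reproducing_above:
  assumes hol: "g holomorphic_on UNIV"
    and bound: "\<And>z. cmod (g z) \<le> M * exp (\<tau> * \<bar>Im z\<bar>)"
    and \<tau>: "0 \<le> \<tau>" "\<tau> < \<sigma>"
  shows "((\<lambda>R. integral {-R..R} (\<lambda>x. g (of_real x) * of_real (dirichlet \<sigma> x))) \<longlongrightarrow> g 0) at_top"
proof -
  have "0 \<le> M" using order_trans[OF norm_ge_zero bound[of 0]] by simp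
  \<comment> \<open>The difference quotient with its singularity at 0 removed; it gains the factor
    1/|z|.\<close>
  define q where "q z = (if z = 0 then deriv g 0 else (g z - g 0) / (z - 0))" for z
  have hol_q: "q holomorphic_on UNIV"
    unfolding q_def by (rule pole_lemma[OF hol]) simp
  have g_eq: "g z = g 0 + z * q z" for z
    by (simp add: q_def)
  have q_bound: "cmod (q z) \<le> (2 * M) * exp (\<tau> * \<bar>Im z\<bar>) / cmod z" if "z \<noteq> 0" for z
  proof -
    have "1 \<le> exp (\<tau> * \<bar>Im z\<bar>)" using \<tau> by simp
    then have "M * 1 \<le> M * exp (\<tau> * \<bar>Im z\<bar>)"
      using \<open>0 \<le> M\<close> by (rule mult_left_mono)
    then have "cmod (g 0) \<le> M * exp (\<tau> * \<bar>Im z\<bar>)"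
      using bound[of 0] by simp
    then have "cmod (g z - g 0) \<le> (2 * M) * exp (\<tau> * \<bar>Im z\<bar>)"
      using bound[of z] norm_triangle_ineq4[of "g z" "g 0"] by linarith
    then show ?thesis
      using that by (simp add: q_def norm_divide divide_right_mono)
  qed
  define E where "E q R = integral {-R..R} (\<lambda>x. q (of_real x) * exp (\<i> * of_real (\<sigma> * x)))"
    for q :: "complex \<Rightarrow> complex" and R
  have E1: "(E q \<longlongrightarrow> 0) at_top"
    unfolding E_def [abs_def] by (rule oscillatory_integral_tendsto_0[OF hol_q q_bound \<tau>(2)])
  \<comment> \<open>Reflecting x -> -x turns the exponential with -\<sigma> into the one with
    \<sigma>, so the upper half-plane serves both.\<close>
  have E2: "(E (\<lambda>z. q (- z)) \<longlongrightarrow> 0) at_top"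
    unfolding E_def [abs_def]
  proof (rule oscillatory_integral_tendsto_0[OF _ _ \<tau>(2)])
    show "(\<lambda>z. q (- z)) holomorphic_on UNIV"
      by (intro holomorphic_on_compose_entire[OF hol_q] holomorphic_intros)
    show "cmod (q (- z)) \<le> (2 * M) * exp (\<tau> * \<bar>Im z\<bar>) / cmod z" if "z \<noteq> 0" for z
      using q_bound[of "- z"] that by simp
  qed
  have cont_q: "continuous_on A (on_reals q)" for A
    by (rule continuous_on_on_reals[OF hol_q])
  have cont: "continuous_on A (\<lambda>x. on_reals q x * exp (\<i> * of_real (\<sigma> * x)))"
    "continuous_on A (\<lambda>x. on_reals q x * exp (- (\<i> * of_real (\<sigma> * x))))" for A
    by (intro continuous_intros cont_q)+
  have eq: "integral {-R..R} (\<lambda>x. g (of_real x) * of_real (dirichlet \<sigma> x))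
      = g 0 * of_real (integral {-R..R} (dirichlet \<sigma>))
        + (E q R - E (\<lambda>z. q (- z)) R) / (2 * \<i> * of_real pi)" for R
  proof -
    have "g (of_real x) * of_real (dirichlet \<sigma> x)
        = g 0 * of_real (dirichlet \<sigma> x)
          + (on_reals q x * exp (\<i> * of_real (\<sigma> * x)) - on_reals q x * exp (- (\<i> * of_real (\<sigma> * x))))
            / (2 * \<i> * of_real pi)" for x
    proof -
      have sin: "of_real (sin (\<sigma> * x)) = (exp (\<i> * of_real (\<sigma> * x)) - exp (- (\<i> * of_real (\<sigma> * x)))) / (2 * \<i>)"
        using sin_exp_eq[of "of_real (\<sigma> * x) :: complex"] by (simp only: sin_of_real)
      have "on_reals q x * of_real (sin (\<sigma> * x) / pi)
          = (on_reals q x * exp (\<i> * of_real (\<sigma> * x)) - on_reals q x * exp (- (\<i> * of_real (\<sigma> * x))))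
            / (2 * \<i> * of_real pi)"
        unfolding of_real_divide sin
        by (simp only: right_diff_distrib[symmetric] times_divide_eq_right divide_divide_eq_left)
      moreover have "g (of_real x) * of_real (dirichlet \<sigma> x)
          = g 0 * of_real (dirichlet \<sigma> x) + on_reals q x * of_real (x * dirichlet \<sigma> x)"
        by (subst g_eq) (simp add: algebra_simps)
      ultimately show ?thesis
        by (simp only: mult_dirichlet)
    qed
    then have "integral {-R..R} (\<lambda>x. g (of_real x) * of_real (dirichlet \<sigma> x))
        = integral {-R..R} (\<lambda>x. g 0 * of_real (dirichlet \<sigma> x)
          + (on_reals q x * exp (\<i> * of_real (\<sigma> * x)) - on_reals q x * exp (- (\<i> * of_real (\<sigma> * x))))
            / (2 * \<i> * of_real pi))"
      by (intro integral_cong)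
    also have "\<dots> = g 0 * integral {-R..R} (\<lambda>x. of_real (dirichlet \<sigma> x))
        + (integral {-R..R} (\<lambda>x. on_reals q x * exp (\<i> * of_real (\<sigma> * x)))
           - integral {-R..R} (\<lambda>x. on_reals q x * exp (- (\<i> * of_real (\<sigma> * x))))) / (2 * \<i> * of_real pi)"
      by (subst integral_add)
         (auto intro!: integrable_continuous_real continuous_intros cont continuous_on_dirichlet
            simp del: of_real_mult simp: integral_diff[OF integrable_continuous_real[OF cont(1)]
               integrable_continuous_real[OF cont(2)]])
    also have "integral {-R..R} (\<lambda>x. of_real (dirichlet \<sigma> x) :: complex)
        = of_real (integral {-R..R} (dirichlet \<sigma>))"
      by (intro integral_unique has_integral_of_real integrable_integral
          integrable_continuous_real continuous_on_dirichlet)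
    also have "integral {-R..R} (\<lambda>x. on_reals q x * exp (- (\<i> * of_real (\<sigma> * x)))) = E (\<lambda>z. q (- z)) R"
      using Henstock_Kurzweil_Integration.integral_reflect_real[of R "-R" "\<lambda>x. on_reals q x * exp (- (\<i> * of_real (\<sigma> * x)))"]
      by (simp add: E_def)
    finally show ?thesis by (simp add: E_def)
  qed
  have "((\<lambda>R. g 0 * of_real (integral {-R..R} (dirichlet \<sigma>))
      + (E q R - E (\<lambda>z. q (- z)) R) / (2 * \<i> * of_real pi))
      \<longlongrightarrow> g 0 * of_real 1 + (0 - 0) / (2 * \<i> * of_real pi)) at_top"
    using \<tau> by (intro tendsto_intros E1 E2 integral_dirichlet_tendsto) auto
  then show ?thesis
    by (simp add: eq)
qed

text \<open>At \<sigma> = pi the contour argument gives no decay, so the identity is taken from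
  \<sigma> > pi to the limit by dominated convergence. The real part reflects that
  \<open>L2_inner\<close> is real.\<close>

theorem PW2_reproducing:
  assumes g: "g \<in> PW2"
  shows "L2_inner (on_reals g) (\<lambda>x. of_real (dirichlet pi x)) = Re (g 0)"
proof -
  have hol: "g holomorphic_on UNIV" and type: "exp_type_at_most pi g" and L2: "L2 (on_reals g)"
    using g by (auto simp: PW2_iff_L2)
  have "L2 (on_reals (deriv g))"
    using PW2_deriv[OF g] by (simp add: PW2_iff_L2)
  then obtain M where M: "\<And>x. cmod (on_reals g x) \<le> M"
    using L2_derivative_imp_bounded[OF on_reals_has_vector_derivative[OF hol] L2] by blast
  have bound: "cmod (g z) \<le> M * exp (pi * \<bar>Im z\<bar>)" for z
    by (rule exp_type_bound[OF hol type M])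
  define w where "w x = (cmod (on_reals g x))\<^sup>2 + 5 * inverse (1 + x\<^sup>2)" for x
  have w: "integrable lborel w"
    unfolding w_def using L2_norm2_integrable[OF L2] integrable_inverse_1_plus_square_lborel by simp
  have cont: "continuous_on A (\<lambda>x. on_reals g x * of_real (dirichlet \<sigma> x))" for A \<sigma>
    by (intro continuous_intros continuous_on_on_reals hol continuous_on_dirichlet)
  have dominated: "cmod (on_reals g x * of_real (dirichlet \<sigma> x)) \<le> w x" if "pi \<le> \<sigma>" "\<sigma> \<le> 2 * pi" for x \<sigma>
  proof -
    have "cmod (on_reals g x * of_real (dirichlet \<sigma> x)) = \<bar>cmod (on_reals g x) \<bullet> dirichlet \<sigma> x\<bar>"
      by (simp add: norm_mult abs_mult)
    also have "\<dots> \<le> (cmod (on_reals g x))\<^sup>2 + (dirichlet \<sigma> x)\<^sup>2"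
      using abs_inner_le_sum_squares[of "cmod (on_reals g x)" "dirichlet \<sigma> x"] by simp
    also have "\<dots> \<le> w x"
      unfolding w_def using that pi_ge_zero
      by (intro add_left_mono dirichlet_bound) linarith+
    finally show ?thesis .
  qed
  have int: "integrable lborel (\<lambda>x. on_reals g x * of_real (dirichlet \<sigma> x))" if "pi \<le> \<sigma>" "\<sigma> \<le> 2 * pi" for \<sigma>
  proof (rule Bochner_Integration.integrable_bound[OF w])
    show "(\<lambda>x. on_reals g x * of_real (dirichlet \<sigma> x)) \<in> borel_measurable lborel"
      using borel_measurable_continuous_onI[OF cont] by simp
    show "AE x in lborel. norm (on_reals g x * of_real (dirichlet \<sigma> x)) \<le> norm (w x)"
      using dominated[OF that] by (intro AE_I2) (smt (verit) real_norm_def)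
  qed
  \<comment> \<open>Decreases to pi from 2 pi, inside the range of the uniform kernel bound.\<close>
  define s where "s n = pi + pi / real (Suc n)" for n
  have s: "pi < s n" "s n \<le> 2 * pi" for n
    by (auto simp: s_def field_simps)
  have s_eq: "(\<integral>x. on_reals g x * of_real (dirichlet (s n) x) \<partial>lborel) = g 0" for n
  proof (rule tendsto_unique)
    show "((\<lambda>R. integral {-R..R} (\<lambda>x. on_reals g x * of_real (dirichlet (s n) x)))
        \<longlongrightarrow> (\<integral>x. on_reals g x * of_real (dirichlet (s n) x) \<partial>lborel)) at_top"
      using s[of n] by (intro integral_Icc_tendsto_lborel cont int) auto
    show "((\<lambda>R. integral {-R..R} (\<lambda>x. on_reals g x * of_real (dirichlet (s n) x))) \<longlongrightarrow> g 0) at_top"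
      by (rule reproducing_above[OF hol bound pi_ge_zero s(1)])
  qed simp
  have s_lim: "s \<longlonglongrightarrow> pi"
    unfolding s_def by real_asymp
  have "(\<lambda>n. \<integral>x. on_reals g x * of_real (dirichlet (s n) x) \<partial>lborel)
      \<longlonglongrightarrow> (\<integral>x. on_reals g x * of_real (dirichlet pi x) \<partial>lborel)"
  proof (rule integral_dominated_convergence[OF _ _ w])
    have "(\<lambda>x. on_reals g x * of_real (dirichlet \<sigma> x)) \<in> borel_measurable lborel" for \<sigma>
      using borel_measurable_continuous_onI[OF cont] by simp
    then show "(\<lambda>x. on_reals g x * of_real (dirichlet pi x)) \<in> borel_measurable lborel"
      "(\<lambda>x. on_reals g x * of_real (dirichlet (s n) x)) \<in> borel_measurable lborel" for n
      by auto
    show "AE x in lborel. norm (on_reals g x * of_real (dirichlet (s n) x)) \<le> w x" for n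
      using s[of n] by (intro AE_I2 dominated) auto
    have "(\<lambda>n. dirichlet (s n) x) \<longlonglongrightarrow> dirichlet pi x" for x
      by (rule tendsto_compose[OF dirichlet_tendsto s_lim])
    then show "AE x in lborel. (\<lambda>n. on_reals g x * of_real (dirichlet (s n) x))
        \<longlonglongrightarrow> on_reals g x * of_real (dirichlet pi x)"
      by (intro AE_I2 tendsto_intros)
  qed
  then have *: "(\<integral>x. on_reals g x * of_real (dirichlet pi x) \<partial>lborel) = g 0"
    unfolding s_eq by (simp add: LIMSEQ_const_iff)
  have "L2_inner (on_reals g) (\<lambda>x. of_real (dirichlet pi x)) = (\<integral>x. Re (on_reals g x * of_real (dirichlet pi x)) \<partial>lborel)"
    by (simp add: L2_inner_def inner_complex_def)
  also have "\<dots> = Re (\<integral>x. on_reals g x * of_real (dirichlet pi x) \<partial>lborel)"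
    using int[of pi] by (intro integral_Re) auto
  finally show ?thesis by (simp add: *)
qed

subsection \<open>The reproducing kernel of the weighted form\<close>

lemma has_vector_derivative_continuous_on:
  assumes "\<And>x. x \<in> S \<Longrightarrow> (f has_vector_derivative f' x) (at x within S)"
  shows "continuous_on S f"
  unfolding continuous_on_eq_continuous_within
  using has_vector_derivative_continuous[OF assms] by blast

section \<open>Fourier transforms of densities on [-pi, pi]\<close>

text \<open>An unnormalized Fourier-Laplace integral; any factor 1 / (2 pi) belongs to the density,
  whose values outside the band do not matter.\<close>

definition band_transform :: "(real \<Rightarrow> complex) \<Rightarrow> complex \<Rightarrow> complex" where
  "band_transform \<phi> z = integral {-pi..pi} (\<lambda>t. exp (\<i> * z * of_real t) * \<phi> t)"

lemma band_transform_integrable: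
  assumes "continuous_on {-pi..pi} \<phi>"
  shows "(\<lambda>t. exp (\<i> * z * of_real t) * \<phi> t) integrable_on {-pi..pi}"
  by (intro integrable_continuous_real continuous_intros assms)

lemma band_transform_has_field_derivative:
  assumes \<phi>: "continuous_on {-pi..pi} \<phi>"
  shows "(band_transform \<phi> has_field_derivative band_transform (\<lambda>t. \<i> * of_real t * \<phi> t) z) (at z)"
proof -
  have "((\<lambda>z. integral (cbox (-pi) pi) (\<lambda>t. exp (\<i> * z * of_real t) * \<phi> t)) has_field_derivative
      integral (cbox (-pi) pi) (\<lambda>t. exp (\<i> * z * of_real t) * (\<i> * of_real t * \<phi> t))) (at z within UNIV)"
  proof (rule leibniz_rule_field_derivative)
    show "((\<lambda>z. exp (\<i> * z * of_real t) * \<phi> t) has_field_derivative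
        exp (\<i> * w * of_real t) * (\<i> * of_real t * \<phi> t)) (at w within UNIV)" for w t
      by (auto intro!: derivative_eq_intros simp: mult_ac)
    show "(\<lambda>t. exp (\<i> * w * of_real t) * \<phi> t) integrable_on cbox (-pi) pi" for w
      using band_transform_integrable[OF \<phi>] by simp
    have "continuous_on (UNIV \<times> cbox (-pi) pi)
        (\<lambda>p. exp (\<i> * fst p * of_real (snd p)) * (\<i> * of_real (snd p) * \<phi> (snd p)))"
      by (intro continuous_intros continuous_on_compose2[OF \<phi>]) auto
    then show "continuous_on (UNIV \<times> cbox (-pi) pi)
        (\<lambda>(z, t). exp (\<i> * z * of_real t) * (\<i> * of_real t * \<phi> t))"
      by (simp add: case_prod_unfold)
  qed auto
  then show ?thesis
    by (simp add: band_transform_def [abs_def])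
qed

lemma band_transform_holomorphic:
  "continuous_on {-pi..pi} \<phi> \<Longrightarrow> band_transform \<phi> holomorphic_on UNIV"
  using band_transform_has_field_derivative by (auto simp: holomorphic_on_open)

lemma deriv_band_transform:
  "continuous_on {-pi..pi} \<phi> \<Longrightarrow> deriv (band_transform \<phi>) = band_transform (\<lambda>t. \<i> * of_real t * \<phi> t)"
  using DERIV_imp_deriv[OF band_transform_has_field_derivative] by blast

lemma band_transform_bound:
  assumes \<phi>: "continuous_on {-pi..pi} \<phi>"
  shows "cmod (band_transform \<phi> z) \<le> integral {-pi..pi} (\<lambda>t. cmod (\<phi> t)) * exp (pi * \<bar>Im z\<bar>)"
proof -
  have "cmod (band_transform \<phi> z) \<le> integral {-pi..pi} (\<lambda>t. cmod (\<phi> t) * exp (pi * \<bar>Im z\<bar>))"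
    unfolding band_transform_def
  proof (rule integral_norm_bound_integral[OF band_transform_integrable[OF \<phi>]])
    show "(\<lambda>t. cmod (\<phi> t) * exp (pi * \<bar>Im z\<bar>)) integrable_on {-pi..pi}"
      by (intro integrable_continuous_real continuous_intros \<phi>)
    fix t assume t: "t \<in> {-pi..pi}"
    have "- (Im z * t) \<le> \<bar>t\<bar> * \<bar>Im z\<bar>"
      by (metis abs_ge_minus_self abs_mult mult.commute)
    also have "\<dots> \<le> pi * \<bar>Im z\<bar>"
      using t by (intro mult_right_mono) auto
    finally have "exp (- (Im z * t)) \<le> exp (pi * \<bar>Im z\<bar>)"
      by simp
    then have "exp (- (Im z * t)) * cmod (\<phi> t) \<le> exp (pi * \<bar>Im z\<bar>) * cmod (\<phi> t)"
      by (rule mult_right_mono) simp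
    then show "norm (exp (\<i> * z * of_real t) * \<phi> t) \<le> cmod (\<phi> t) * exp (pi * \<bar>Im z\<bar>)"
      by (simp add: norm_mult mult.commute)
  qed
  then show ?thesis by simp
qed

lemma band_transform_exp_type:
  assumes \<phi>: "continuous_on {-pi..pi} \<phi>"
  shows "exp_type_at_most pi (band_transform \<phi>)"
  unfolding exp_type_at_most_def
proof (intro allI impI)
  fix \<epsilon> :: real assume \<epsilon>: "0 < \<epsilon>"
  define I where "I = integral {-pi..pi} (\<lambda>t. cmod (\<phi> t))"
  have "0 \<le> I"
    unfolding I_def by (intro integral_nonneg integrable_continuous_real continuous_intros \<phi>) auto
  have "cmod (band_transform \<phi> z) \<le> (I + 1) * exp ((pi + \<epsilon>) * cmod z)" for z
  proof -
    have "pi * \<bar>Im z\<bar> \<le> (pi + \<epsilon>) * cmod z"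
      using \<epsilon> abs_Im_le_cmod[of z] by (intro mult_mono) auto
    then have "I * exp (pi * \<bar>Im z\<bar>) \<le> (I + 1) * exp ((pi + \<epsilon>) * cmod z)"
      using \<open>0 \<le> I\<close> by (intro mult_mono) auto
    then show ?thesis
      using band_transform_bound[OF \<phi>, of z] by (simp add: I_def)
  qed
  then show "\<exists>C>0. \<forall>z. cmod (band_transform \<phi> z) \<le> C * exp ((pi + \<epsilon>) * cmod z)"
    using \<open>0 \<le> I\<close> by (intro exI[of _ "I + 1"]) simp
qed

text \<open>Integrate the derivative of exp(i z t) \<phi>(t) over the band. The identity yields both
  decay on the real line and the transform of a constant.\<close>

lemma band_transform_parts:
  assumes \<phi>: "\<And>t. t \<in> {-pi..pi} \<Longrightarrow> (\<phi> has_vector_derivative \<phi>' t) (at t within {-pi..pi})"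
    and \<phi>': "continuous_on {-pi..pi} \<phi>'"
  shows "\<i> * z * band_transform \<phi> z
    = exp (\<i> * z * of_real pi) * \<phi> pi - exp (- (\<i> * z * of_real pi)) * \<phi> (- pi) - band_transform \<phi>' z"
proof -
  have cont: "continuous_on {-pi..pi} \<phi>"
    using \<phi> by (rule has_vector_derivative_continuous_on)
  have 1: "((\<lambda>t. \<i> * z * (exp (\<i> * z * of_real t) * \<phi> t) + exp (\<i> * z * of_real t) * \<phi>' t) has_integral
      exp (\<i> * z * of_real pi) * \<phi> pi - exp (\<i> * z * of_real (- pi)) * \<phi> (- pi)) {-pi..pi}"
  proof (rule fundamental_theorem_of_calculus)
    fix t assume t: "t \<in> {-pi..pi}"
    have "((\<lambda>t. exp (\<i> * z * of_real t)) has_vector_derivative \<i> * z * exp (\<i> * z * of_real t))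
        (at t within {-pi..pi})"
      by (rule has_vector_derivative_real_field) (auto intro!: derivative_eq_intros)
    from has_vector_derivative_mult[OF this \<phi>[OF t]]
    show "((\<lambda>t. exp (\<i> * z * of_real t) * \<phi> t) has_vector_derivative
        \<i> * z * (exp (\<i> * z * of_real t) * \<phi> t) + exp (\<i> * z * of_real t) * \<phi>' t) (at t within {-pi..pi})"
      by (simp add: algebra_simps)
  qed simp
  have 2: "((\<lambda>t. \<i> * z * (exp (\<i> * z * of_real t) * \<phi> t) + exp (\<i> * z * of_real t) * \<phi>' t) has_integral
      \<i> * z * band_transform \<phi> z + band_transform \<phi>' z) {-pi..pi}"
    unfolding band_transform_def
    by (intro has_integral_add has_integral_mult_right integrable_integral
        band_transform_integrable cont \<phi>')
  show ?thesis
    using has_integral_unique[OF 1 2] by (simp add: eq_diff_eq)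
qed

text \<open>Square integrability comes from decay instead of Plancherel: the transform is bounded by
  A, and integration by parts bounds its product with x by D. The price is a continuously
  differentiable density.\<close>

lemma band_transform_PW2:
  assumes \<phi>: "\<And>t. t \<in> {-pi..pi} \<Longrightarrow> (\<phi> has_vector_derivative \<phi>' t) (at t within {-pi..pi})"
    and \<phi>': "continuous_on {-pi..pi} \<phi>'"
  shows "band_transform \<phi> \<in> PW2"
proof -
  have cont: "continuous_on {-pi..pi} \<phi>"
    using \<phi> by (rule has_vector_derivative_continuous_on)
  define A where "A = integral {-pi..pi} (\<lambda>t. cmod (\<phi> t))"
  define D where "D = cmod (\<phi> pi) + cmod (\<phi> (- pi)) + integral {-pi..pi} (\<lambda>t. cmod (\<phi>' t))"
  have bound: "(cmod (on_reals (band_transform \<phi>) x))\<^sup>2 \<le> (A\<^sup>2 + D\<^sup>2) * inverse (1 + x\<^sup>2)" for x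
  proof -
    have "cmod (on_reals (band_transform \<phi>) x) \<le> A"
      using band_transform_bound[OF cont, of "of_real x"] by (simp add: A_def)
    then have 1: "(cmod (on_reals (band_transform \<phi>) x))\<^sup>2 \<le> A\<^sup>2"
      by (rule power_mono) simp
    have "\<bar>x\<bar> * cmod (on_reals (band_transform \<phi>) x) = cmod (\<i> * of_real x * band_transform \<phi> (of_real x))"
      by (simp add: norm_mult)
    also have "\<i> * of_real x * band_transform \<phi> (of_real x)
        = exp (\<i> * of_real x * of_real pi) * \<phi> pi
          - exp (- (\<i> * of_real x * of_real pi)) * \<phi> (- pi) - on_reals (band_transform \<phi>') x"
      by (rule band_transform_parts[OF assms])
    also have "cmod \<dots> \<le> cmod (exp (\<i> * of_real x * of_real pi) * \<phi> pi)
        + cmod (exp (- (\<i> * of_real x * of_real pi)) * \<phi> (- pi)) + cmod (on_reals (band_transform \<phi>') x)"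
      by (intro order_trans[OF norm_triangle_ineq4] add_right_mono norm_triangle_ineq4)
    also have "\<dots> \<le> D"
      using band_transform_bound[OF \<phi>', of "of_real x"] by (simp add: D_def norm_mult)
    finally have "(\<bar>x\<bar> * cmod (on_reals (band_transform \<phi>) x))\<^sup>2 \<le> D\<^sup>2"
      by (rule power_mono) simp
    then have "(cmod (on_reals (band_transform \<phi>) x))\<^sup>2 * (1 + x\<^sup>2) \<le> A\<^sup>2 + D\<^sup>2"
      using 1 by (simp add: power_mult_distrib algebra_simps)
    moreover have "0 < 1 + x\<^sup>2" by (simp add: add_pos_nonneg)
    ultimately show ?thesis
      by (simp add: field_simps)
  qed
  have "integrable lborel (\<lambda>x. (cmod (on_reals (band_transform \<phi>) x))\<^sup>2)"
  proof (rule Bochner_Integration.integrable_bound)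
    show "integrable lborel (\<lambda>x. (A\<^sup>2 + D\<^sup>2) * inverse (1 + x\<^sup>2))"
      by (intro integrable_mult_right integrable_inverse_1_plus_square_lborel)
    have "continuous_on UNIV (\<lambda>x. (cmod (on_reals (band_transform \<phi>) x))\<^sup>2)"
      by (intro continuous_intros continuous_on_on_reals band_transform_holomorphic cont)
    then show "(\<lambda>x. (cmod (on_reals (band_transform \<phi>) x))\<^sup>2) \<in> borel_measurable lborel"
      using borel_measurable_continuous_onI by simp
    show "AE x in lborel. norm ((cmod (on_reals (band_transform \<phi>) x))\<^sup>2) \<le> norm ((A\<^sup>2 + D\<^sup>2) * inverse (1 + x\<^sup>2))"
      using bound by (intro AE_I2) (smt (verit) real_norm_def zero_le_power2)
  qed
  then show ?thesis
    using band_transform_holomorphic[OF cont] band_transform_exp_type[OF cont] by (simp add: PW2_def)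
qed

text \<open>With zero derivative only the boundary terms survive and combine to a sine; cancelling i
  x needs x nonzero, so the origin is computed directly.\<close>

lemma band_transform_const:
  "band_transform (\<lambda>t. 1 / (2 * of_real pi)) (of_real x) = of_real (dirichlet pi x)"
proof (cases "x = 0")
  case True
  then show ?thesis by (simp add: band_transform_def dirichlet_0) (simp add: complex_eq_iff)
next
  case False
  have "\<i> * of_real x * band_transform (\<lambda>t. 1 / (2 * of_real pi)) (of_real x)
      = exp (\<i> * of_real x * of_real pi) * (1 / (2 * of_real pi))
        - exp (- (\<i> * of_real x * of_real pi)) * (1 / (2 * of_real pi)) - band_transform (\<lambda>t. 0) (of_real x)"
    by (rule band_transform_parts) (auto intro!: derivative_eq_intros)
  also have "\<dots> = (exp (\<i> * of_real (pi * x)) - exp (- (\<i> * of_real (pi * x)))) / (2 * of_real pi)"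
    by (simp add: band_transform_def diff_divide_distrib mult_ac)
  also have "exp (\<i> * of_real (pi * x)) - exp (- (\<i> * of_real (pi * x))) = 2 * \<i> * of_real (sin (pi * x))"
    using sin_exp_eq[of "of_real (pi * x) :: complex"] by (simp only: sin_of_real) simp
  also have "2 * \<i> * of_real (sin (pi * x)) / (2 * of_real pi) = \<i> * of_real (x * dirichlet pi x)"
    unfolding mult_dirichlet by simp
  finally have eq: "(\<i> * of_real x) * band_transform (\<lambda>t. 1 / (2 * of_real pi)) (of_real x)
      = (\<i> * of_real x) * of_real (dirichlet pi x)"
    by (simp only: of_real_mult mult.assoc)
  have "\<i> * of_real x \<noteq> (0 :: complex)"
    using False by simp
  from mult_left_cancel[OF this, THEN iffD1, OF eq] show ?thesis .
qed

section \<open>The kernel of the weighted form at the origin\<close>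

locale kernel =
  fixes a :: real
  assumes a_pos: "0 < a" and a_less: "a < 1 / pi\<^sup>2"
begin

text \<open>Chosen so that multiplication by 1 - a t^2 gives the constant density 1 / (2 pi) of the
  sinc kernel.\<close>

definition w :: "real \<Rightarrow> complex" where
  "w t = of_real (1 / (1 - a * t\<^sup>2) / (2 * pi))"

definition K :: "complex \<Rightarrow> complex" where
  "K = band_transform w"

lemma sqrt_a_pi_less_1: "sqrt a * pi < 1"
proof -
  have "(sqrt a * pi)\<^sup>2 < 1\<^sup>2"
    using a_pos a_less by (simp add: power_mult_distrib pos_less_divide_eq)
  then show ?thesis by (rule power2_less_imp_less) simp
qed

lemma sqrt_a_mult_less_1: "\<bar>sqrt a * t\<bar> < 1" if "t \<in> {-pi..pi}"
proof -
  have "\<bar>sqrt a * t\<bar> \<le> sqrt a * pi"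
    using that a_pos by (auto simp: abs_mult intro!: mult_left_mono)
  then show ?thesis using sqrt_a_pi_less_1 by linarith
qed

lemma denominator_pos: "0 < 1 - a * t\<^sup>2" if "t \<in> {-pi..pi}"
proof -
  have "(sqrt a * t)\<^sup>2 < 1"
    using sqrt_a_mult_less_1[OF that] by (simp add: abs_square_less_1)
  then show ?thesis using a_pos by (simp add: power_mult_distrib)
qed

lemma w_has_vector_derivative:
  assumes t: "t \<in> {-pi..pi}"
  shows "(w has_vector_derivative of_real (2 * a * t / (1 - a * t\<^sup>2)\<^sup>2 / (2 * pi))) (at t within A)"
proof -
  have "((\<lambda>t. 1 / (1 - a * t\<^sup>2) / (2 * pi)) has_real_derivative 2 * a * t / (1 - a * t\<^sup>2)\<^sup>2 / (2 * pi))
      (at t within A)"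
    using denominator_pos[OF t]
    by (auto intro!: derivative_eq_intros simp: power2_eq_square divide_simps)
  then show ?thesis
    unfolding w_def [abs_def] by (rule has_vector_derivative_of_real)
qed

lemma w_continuous: "continuous_on {-pi..pi} w"
  using w_has_vector_derivative by (rule has_vector_derivative_continuous_on)

lemma K_PW2: "K \<in> PW2"
  unfolding K_def
proof (rule band_transform_PW2[OF w_has_vector_derivative])
  show "continuous_on {-pi..pi} (\<lambda>t. complex_of_real (2 * a * t / (1 - a * t\<^sup>2)\<^sup>2 / (2 * pi)))"
    using denominator_pos by (intro continuous_intros) force+
qed

lemma K_holomorphic: "K holomorphic_on UNIV"
  using K_PW2 by (simp add: PW2_def)

text \<open>Each derivative multiplies the density by i t, so \<open>K\<close> plus a times its
  second derivative has density (1 - a t^2) w(t) = 1 / (2 pi).\<close>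

lemma K_eq: "K (of_real x) + a *\<^sub>R deriv (deriv K) (of_real x) = of_real (dirichlet pi x)"
proof -
  define w1 w2 where "w1 t = \<i> * of_real t * w t" and "w2 t = \<i> * of_real t * w1 t" for t
  have w12: "continuous_on {-pi..pi} w1" "continuous_on {-pi..pi} w2"
    unfolding w2_def w1_def by (intro continuous_intros w_continuous)+
  have "deriv K = band_transform w1"
    unfolding K_def w1_def by (rule deriv_band_transform[OF w_continuous])
  then have "deriv (deriv K) = band_transform w2"
    unfolding w2_def by (simp add: deriv_band_transform[OF w12(1)])
  then have "K (of_real x) + a *\<^sub>R deriv (deriv K) (of_real x)
      = integral {-pi..pi} (\<lambda>t. exp (\<i> * of_real x * of_real t) * w t
          + a *\<^sub>R (exp (\<i> * of_real x * of_real t) * w2 t))"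
    unfolding K_def band_transform_def
    by (subst integral_add)
       (auto intro!: integrable_cmul band_transform_integrable w_continuous w12)
  also have "\<dots> = band_transform (\<lambda>t. 1 / (2 * of_real pi)) (of_real x)"
    unfolding band_transform_def
  proof (rule integral_cong)
    fix t assume t: "t \<in> {-pi..pi}"
    define d where "d = 1 / (1 - a * t\<^sup>2) / (2 * pi)"
    have wt: "w t = of_real d"
      by (simp add: w_def d_def)
    have w2t: "w2 t = - (of_real (t\<^sup>2) * w t)"
    proof -
      have "w2 t = (\<i> * \<i>) * (of_real (t\<^sup>2) * w t)"
        by (simp only: w2_def w1_def power2_eq_square of_real_mult mult_ac)
      then show ?thesis by simp
    qed
    have "w t + a *\<^sub>R w2 t = of_real (d + a * (- (t\<^sup>2 * d)))"
      by (simp only: w2t wt scaleR_conv_of_real of_real_add of_real_mult of_real_minus)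
    also have "d + a * (- (t\<^sup>2 * d)) = (1 - a * t\<^sup>2) * d"
      by (simp add: algebra_simps)
    also have "complex_of_real ((1 - a * t\<^sup>2) * d) = 1 / (2 * of_real pi)"
      using denominator_pos[OF t] by (simp add: d_def)
    finally have "w t + a *\<^sub>R w2 t = 1 / (2 * of_real pi)" .
    then show "exp (\<i> * of_real x * of_real t) * w t + a *\<^sub>R (exp (\<i> * of_real x * of_real t) * w2 t)
        = exp (\<i> * of_real x * of_real t) * (1 / (2 * of_real pi))"
      by (metis distrib_left mult_scaleR_right)
  qed
  also have "\<dots> = of_real (dirichlet pi x)"
    by (rule band_transform_const)
  finally show ?thesis .
qed

lemma K_0: "K 0 = of_real (1 / (2 * pi * sqrt a) * ln ((1 + sqrt a * pi) / (1 - sqrt a * pi)))"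
proof -
  \<comment> \<open>Antiderivative from partial fractions. It is odd, so its increment over the band
    doubles F(pi) and turns 4 into 2 in the denominator.\<close>
  define F where "F t = (ln (1 + sqrt a * t) - ln (1 - sqrt a * t)) / (4 * pi * sqrt a)" for t
  have "((\<lambda>t. 1 / (1 - a * t\<^sup>2) / (2 * pi)) has_integral (F pi - F (- pi))) {-pi..pi}"
  proof (rule fundamental_theorem_of_calculus)
    fix t assume t: "t \<in> {-pi..pi}"
    have pos: "0 < 1 + sqrt a * t" "0 < 1 - sqrt a * t" "0 < sqrt a"
      using sqrt_a_mult_less_1[OF t] a_pos by (auto simp: abs_less_iff)
    have fac: "1 - a * t\<^sup>2 = (1 + sqrt a * t) * (1 - sqrt a * t)"
      using a_pos by (simp add: algebra_simps power2_eq_square)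
    have "((\<lambda>t. ln (1 + sqrt a * t) - ln (1 - sqrt a * t)) has_real_derivative
        (sqrt a / (1 + sqrt a * t) + sqrt a / (1 - sqrt a * t))) (at t)"
      using pos by (auto intro!: derivative_eq_intros)
    then have "(F has_real_derivative
        (sqrt a / (1 + sqrt a * t) + sqrt a / (1 - sqrt a * t)) / (4 * pi * sqrt a)) (at t)"
      unfolding F_def [abs_def] by (rule DERIV_cdivide)
    also have "(sqrt a / (1 + sqrt a * t) + sqrt a / (1 - sqrt a * t)) / (4 * pi * sqrt a)
        = 1 / (1 - a * t\<^sup>2) / (2 * pi)"
      unfolding fac using pos by (simp add: divide_simps) (simp add: algebra_simps)
    finally show "(F has_vector_derivative 1 / (1 - a * t\<^sup>2) / (2 * pi)) (at t within {-pi..pi})"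
      using has_vector_derivative_at_within has_real_derivative_iff_has_vector_derivative by blast
  qed simp
  then have "(w has_integral of_real (F pi - F (- pi))) {-pi..pi}"
    unfolding w_def [abs_def] by (rule has_integral_of_real)
  then have "K 0 = of_real (F pi - F (- pi))"
    by (simp add: K_def band_transform_def integral_unique)
  also have "F pi - F (- pi) = 1 / (2 * pi * sqrt a) * (ln (1 + sqrt a * pi) - ln (1 - sqrt a * pi))"
    using a_pos by (simp add: F_def field_simps)
  also have "ln (1 + sqrt a * pi) - ln (1 - sqrt a * pi) = ln ((1 + sqrt a * pi) / (1 - sqrt a * pi))"
  proof -
    have "0 < sqrt a * pi"
      using a_pos by simp
    then have "1 + sqrt a * pi \<noteq> 0" "1 - sqrt a * pi \<noteq> 0"
      using sqrt_a_pi_less_1 by linarith+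
    then show ?thesis
      by (simp only: ln_div) simp
  qed
  finally show ?thesis .
qed

lemma K_0_pos: "0 < Re (K 0)"
proof -
  have "0 < sqrt a * pi" using a_pos by simp
  then have "1 < (1 + sqrt a * pi) / (1 - sqrt a * pi)"
    using sqrt_a_pi_less_1 by simp
  then show ?thesis
    unfolding K_0 using a_pos by simp
qed

text \<open>Integration by parts moves the derivative from g onto \<open>K\<close>, so the form
  pairs g with K + a K'', which is the sinc kernel by \<open>K_eq\<close>.\<close>

lemma K_reproducing:
  assumes g: "g \<in> PW2"
  shows "L2_inner (on_reals g) (on_reals K) - a * L2_inner (on_reals (deriv g)) (on_reals (deriv K)) = Re (g 0)"
proof -
  have L2: "L2 (on_reals g)" "L2 (on_reals (deriv g))" "L2 (on_reals K)" "L2 (on_reals (deriv K))" "L2 (on_reals (deriv (deriv K)))"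
    using PW2_deriv[OF g] PW2_deriv[OF K_PW2] PW2_deriv[OF PW2_deriv[OF K_PW2]] g K_PW2
    by (auto simp: PW2_iff_L2)
  have hol: "g holomorphic_on UNIV" "deriv K holomorphic_on UNIV"
    using g K_holomorphic by (auto simp: PW2_def intro: holomorphic_deriv)
  have "L2_inner (on_reals (deriv g)) (on_reals (deriv K)) = - L2_inner (on_reals g) (on_reals (deriv (deriv K)))"
    by (rule L2_inner_parts[OF on_reals_has_vector_derivative[OF hol(1)] on_reals_has_vector_derivative[OF hol(2)] L2(1,2,4,5)])
  moreover have "L2_inner (on_reals g) (on_reals K) + a * L2_inner (on_reals g) (on_reals (deriv (deriv K)))
      = L2_inner (on_reals g) (\<lambda>x. on_reals K x + a *\<^sub>R on_reals (deriv (deriv K)) x)"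
    using L2_inner_integrable[OF L2(1,3)] L2_inner_integrable[OF L2(1,5)]
    by (simp add: L2_inner_def inner_add_right)
  ultimately show ?thesis
    using PW2_reproducing[OF g] by (simp add: K_eq)
qed

end

section \<open>Positivity of the form and the inequality\<close>

lemma PW2_add_scaleR:
  assumes f: "f \<in> PW2" and h: "h \<in> PW2"
  shows "(\<lambda>z. f z + c *\<^sub>R h z) \<in> PW2"
proof -
  have "exp_type_at_most pi (\<lambda>z. f z + c *\<^sub>R h z)"
    unfolding exp_type_at_most_def
  proof (intro allI impI)
    fix \<epsilon> :: real assume "0 < \<epsilon>"
    then obtain C D where C: "0 < C" "\<And>z. cmod (f z) \<le> C * exp ((pi + \<epsilon>) * cmod z)"
      and D: "0 < D" "\<And>z. cmod (h z) \<le> D * exp ((pi + \<epsilon>) * cmod z)"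
      using f h unfolding PW2_def exp_type_at_most_def by blast
    have "cmod (f z + c *\<^sub>R h z) \<le> (C + \<bar>c\<bar> * D) * exp ((pi + \<epsilon>) * cmod z)" for z
    proof -
      have "cmod (f z + c *\<^sub>R h z) \<le> cmod (f z) + \<bar>c\<bar> * cmod (h z)"
        using norm_triangle_ineq[of "f z" "c *\<^sub>R h z"] by simp
      also have "\<dots> \<le> C * exp ((pi + \<epsilon>) * cmod z) + \<bar>c\<bar> * (D * exp ((pi + \<epsilon>) * cmod z))"
        by (intro add_mono mult_left_mono C D) simp
      finally show ?thesis by (simp add: algebra_simps)
    qed
    then show "\<exists>C>0. \<forall>z. cmod (f z + c *\<^sub>R h z) \<le> C * exp ((pi + \<epsilon>) * cmod z)"
      using C D by (intro exI[of _ "C + \<bar>c\<bar> * D"]) (simp add: add_pos_nonneg)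
  qed
  moreover have "(\<lambda>z. f z + c *\<^sub>R h z) holomorphic_on UNIV"
    using f h unfolding PW2_def scaleR_conv_of_real by (auto intro!: holomorphic_intros)
  ultimately show ?thesis
    using L2_add[OF _ L2_scaleR] f h by (auto simp: PW2_iff_L2)
qed

text \<open>The integrals are nonnegative extended ones, so the statement is meaningful without
  presupposing that g' is square integrable.\<close>

theorem corollary4:
  fixes a :: real and g :: "complex \<Rightarrow> complex"
  assumes "0 < a" and "a < 1 / pi\<^sup>2"
    and "g \<in> PW2" and "g 0 = 1"
  shows "ennreal a * (\<integral>\<^sup>+ x. ennreal ((cmod (deriv g (complex_of_real x)))\<^sup>2) \<partial>lborel)
           + ennreal (inverse (1 / (2 * pi * sqrt a) * ln ((1 + sqrt a * pi) / (1 - sqrt a * pi))))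
         \<le> (\<integral>\<^sup>+ x. ennreal ((cmod (g (complex_of_real x)))\<^sup>2) \<partial>lborel)"
proof -
  interpret kernel a by unfold_locales (use assms in auto)
  define \<kappa> where "\<kappa> = 1 / (2 * pi * sqrt a) * ln ((1 + sqrt a * pi) / (1 - sqrt a * pi))"
  have K0: "Re (K 0) = \<kappa>"
    unfolding K_0 \<kappa>_def by (rule Re_complex_of_real)
  have "0 < \<kappa>" using K_0_pos K0 by simp
  note g = \<open>g \<in> PW2\<close>
  have L2: "L2 (on_reals g)" "L2 (on_reals (deriv g))" "L2 (on_reals K)" "L2 (on_reals (deriv K))"
    using PW2_deriv[OF g] PW2_deriv[OF K_PW2] g K_PW2 by (auto simp: PW2_iff_L2)
  have hol: "g holomorphic_on UNIV" using g by (simp add: PW2_def)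
  \<comment> \<open>The minimizer of c -> B(g, g) + 2 c + c^2 \<kappa>, whose minimum is B(g, g) - 1
    / \<kappa>, where B is the weighted form.\<close>
  define c where "c = - (1 / \<kappa>)"
  define h where "h z = g z + c *\<^sub>R K z" for z
  have h: "h \<in> PW2"
    unfolding h_def by (rule PW2_add_scaleR[OF g K_PW2])
  have "deriv h z = deriv g z + c *\<^sub>R deriv K z" for z
    unfolding h_def scaleR_conv_of_real
    by (intro DERIV_imp_deriv DERIV_add DERIV_cmult has_field_derivative_entire hol K_holomorphic)
  then have nrm_h': "L2_sqnorm (on_reals (deriv h))
      = L2_sqnorm (on_reals (deriv g)) + 2 * c * L2_inner (on_reals (deriv g)) (on_reals (deriv K)) + c\<^sup>2 * L2_sqnorm (on_reals (deriv K))"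
    using L2_sqnorm_add_scaleR[OF L2(2,4), of c] by simp
  have nrm_h: "L2_sqnorm (on_reals h) = L2_sqnorm (on_reals g) + 2 * c * L2_inner (on_reals g) (on_reals K) + c\<^sup>2 * L2_sqnorm (on_reals K)"
    using L2_sqnorm_add_scaleR[OF L2(1,3), of c] by (simp add: h_def)
  \<comment> \<open>Bernstein's inequality and a pi^2 < 1 make the form nonnegative at
    \<open>h\<close>.\<close>
  have "a * L2_sqnorm (on_reals (deriv h)) \<le> a * (pi\<^sup>2 * L2_sqnorm (on_reals h))"
    using PW2_Bernstein[OF h] a_pos by (intro mult_left_mono) auto
  also have "\<dots> = (a * pi\<^sup>2) * L2_sqnorm (on_reals h)"
    by simp
  also have "\<dots> \<le> 1 * L2_sqnorm (on_reals h)"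
    using a_less by (intro mult_right_mono L2_sqnorm_nonneg) (simp add: pos_less_divide_eq)
  finally have "0 \<le> L2_sqnorm (on_reals h) - a * L2_sqnorm (on_reals (deriv h))"
    by simp
  also have "\<dots> = (L2_sqnorm (on_reals g) - a * L2_sqnorm (on_reals (deriv g)))
      + 2 * c * (L2_inner (on_reals g) (on_reals K) - a * L2_inner (on_reals (deriv g)) (on_reals (deriv K)))
      + c\<^sup>2 * (L2_sqnorm (on_reals K) - a * L2_sqnorm (on_reals (deriv K)))"
    unfolding nrm_h nrm_h' by (simp add: algebra_simps)
  \<comment> \<open>The reproducing identity applied to \<open>K\<close> itself.\<close>
  also have "L2_sqnorm (on_reals K) - a * L2_sqnorm (on_reals (deriv K)) = \<kappa>"
    using K_reproducing[OF K_PW2] K0 by (simp add: L2_sqnorm_def L2_inner_def power2_norm_eq_inner)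
  also have "L2_inner (on_reals g) (on_reals K) - a * L2_inner (on_reals (deriv g)) (on_reals (deriv K)) = 1"
    using K_reproducing[OF g] \<open>g 0 = 1\<close> by simp
  finally have main: "a * L2_sqnorm (on_reals (deriv g)) + inverse \<kappa> \<le> L2_sqnorm (on_reals g)"
    using \<open>0 < \<kappa>\<close> by (simp add: c_def power2_eq_square field_simps)
  have nn: "(\<integral>\<^sup>+ x. ennreal ((cmod (on_reals f x))\<^sup>2) \<partial>lborel) = ennreal (L2_sqnorm (on_reals f))" if "L2 (on_reals f)" for f
    unfolding L2_sqnorm_def by (rule nn_integral_eq_integral[OF L2_norm2_integrable[OF that]]) simp
  have "ennreal a * ennreal (L2_sqnorm (on_reals (deriv g))) + ennreal (inverse \<kappa>)
      = ennreal (a * L2_sqnorm (on_reals (deriv g)) + inverse \<kappa>)"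
    using a_pos \<open>0 < \<kappa>\<close> by (simp add: ennreal_mult L2_sqnorm_nonneg)
  then show ?thesis
    unfolding nn[OF L2(1)] nn[OF L2(2)] \<kappa>_def[symmetric] using main by (simp add: ennreal_leI)
qed

end
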